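(* Let $G$ and $H$ be finitely generated groups, let $\mathcal{P}$ be a finite collection of subgroups of $G$ and $\mathcal{Q}$ a finite collection of subgroups of $H$. Let $q\colon(G,\mathcal{P})\to(H,\mathcal{Q})$ be a quasi-isometry of pairs. Suppose $\mathcal{P}$ and $\mathcal{Q}$ are reduced. Then there is an induced quasi-isometry of graphs $\hat q\colon\hat\Gamma(G,\mathcal{P})\to\hat\Gamma(H,\mathcal{Q})$, and if $\hat\Gamma(H,\mathcal{Q})$ is a fine graph then $\hat\Gamma(G,\mathcal{P})$ is a fine graph.
   Context: **Quasi-isometry of pairs.** Fix word metrics on $G$, $H$ with respect to finite generating sets. $\mathsf{hdist}_H$ denotes Hausdorff distance between subsets of $H$; $G/\mathcal{P}$ is the set of all left cosets $gP$ with $g\in G$, $P\in\mathcal{P}$. For $L\ge1$, $C,M\ge0$, an $(L,C,M)$-quasi-isometry of pairs $q\colon(G,\mathcal{P})\to(H,\mathcal{Q})$ is an $(L,C)$-quasi-isometry $q\colon G\to H$ such that the relation $\dot q=\{(A,B)\in G/\mathcal{P}\times H/\mathcal{Q}\colon\mathsf{hdist}_H(q(A),B)<M\}$ has surjective projections to $G/\mathcal{P}$ and $H/\mathcal{Q}$. A quasi-isometry of pairs is an $(L,C,M)$-quasi-isometry of pairs for some constants. **Reduced.** A collection $\mathcal{P}$ of subgroups of $G$ is reduced if for any $P,Q\in\mathcal{P}$ and $g\in G$, if $P$ and $gQg^{-1}$ are commensurable subgroups (their intersection has finite index in both) then $P=Q$ and $g\in P$. **Coned-off Cayley graph.** For a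 generating set $S$ of $G$, $\hat\Gamma(G,\mathcal{P},S)$ is the simplicial graph with vertex set $G\cup G/\mathcal{P}$ and edges $\{g,gs\}$ for $g\in G$, $s\in S$, and $\{x,gP\}$ for $g\in G$, $P\in\mathcal{P}$, $x\in gP$. $\hat\Gamma(G,\mathcal{P})$ denotes this graph with respect to some finite generating set of $G$. A quasi-isometry between connected graphs is a function between vertex sets that is a quasi-isometry for the path metrics. "Induced" means $\hat q=q\cup\dot q$: the restriction of $\hat q$ to $G$ is $q$, and $\hat q$ maps a vertex $A\in G/\mathcal{P}$ to the vertex $B\in H/\mathcal{Q}$ with $(A,B)\in\dot q$. **Fine.** A circuit is an embedded closed path. A graph is fine if for every $n\ge0$ and every edge $e$ there are only finitely many circuits of length at most $n$ containing $e$. *)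

theory Defs
  imports
    Complex_Main
    "HOL-Library.Extended_Real"
    "HOL-Algebra.Left_Coset"
    "HOL-Algebra.Generated_Groups"
begin

section \<open>Word metrics\<close>

definition finite_generating_set :: "('a, 'm) monoid_scheme \<Rightarrow> 'a set \<Rightarrow> bool" where
  "finite_generating_set G S \<longleftrightarrow> finite S \<and> S \<subseteq> carrier G \<and> generate G S = carrier G"

text \<open>The least length of a word in \<open>S\<close> and the inverses of \<open>S\<close> that represents \<open>g\<^sup>-\<^sup>1h\<close>. Such a
  word exists whenever \<open>S\<close> generates \<open>G\<close>.\<close>

definition word_dist :: "('a, 'm) monoid_scheme \<Rightarrow> 'a set \<Rightarrow> 'a \<Rightarrow> 'a \<Rightarrow> real" where
  "word_dist G S g h = real (LEAST n. \<exists>ws. length ws = n \<and> set ws \<subseteq> S \<union> m_inv G ` S \<and>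
     foldr (mult G) ws \<one>\<^bsub>G\<^esub> = inv\<^bsub>G\<^esub> g \<otimes>\<^bsub>G\<^esub> h)"


section \<open>Quasi-isometries of pairs\<close>

definition quasi_isometry ::
  "real \<Rightarrow> real \<Rightarrow> 'x set \<Rightarrow> ('x \<Rightarrow> 'x \<Rightarrow> real) \<Rightarrow> 'y set \<Rightarrow> ('y \<Rightarrow> 'y \<Rightarrow> real) \<Rightarrow> ('x \<Rightarrow> 'y) \<Rightarrow> bool"
where
  "quasi_isometry L C X dX Y dY f \<longleftrightarrow>
     L \<ge> 1 \<and> C \<ge> 0 \<and> f \<in> X \<rightarrow> Y \<and>
     (\<forall>x\<in>X. \<forall>x'\<in>X. dX x x' / L - C \<le> dY (f x) (f x') \<and> dY (f x) (f x') \<le> L * dX x x' + C) \<and>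
     (\<forall>y\<in>Y. \<exists>x\<in>X. dY (f x) y \<le> C)"

definition hdist :: "('x \<Rightarrow> 'x \<Rightarrow> real) \<Rightarrow> 'x set \<Rightarrow> 'x set \<Rightarrow> ereal" where
  "hdist d A B = max (SUP a\<in>A. INF b\<in>B. ereal (d a b)) (SUP b\<in>B. INF a\<in>A. ereal (d a b))"

definition cosets :: "('a, 'm) monoid_scheme \<Rightarrow> 'a set set \<Rightarrow> 'a set set" where
  "cosets G \<P> = (\<Union>P\<in>\<P>. lcosets\<^bsub>G\<^esub> P)"

definition coset_rel ::
  "('a, 'm) monoid_scheme \<Rightarrow> 'a set set \<Rightarrow> ('b, 'n) monoid_scheme \<Rightarrow> 'b set \<Rightarrow> 'b set set
     \<Rightarrow> real \<Rightarrow> ('a \<Rightarrow> 'b) \<Rightarrow> ('a set \<times> 'b set) set" where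
  "coset_rel G \<P> H T \<Q> M q =
     {(A, B) \<in> cosets G \<P> \<times> cosets H \<Q>. hdist (word_dist H T) (q ` A) B < ereal M}"

definition quasi_isometry_of_pairs ::
  "real \<Rightarrow> real \<Rightarrow> real \<Rightarrow> ('a, 'm) monoid_scheme \<Rightarrow> 'a set \<Rightarrow> 'a set set
     \<Rightarrow> ('b, 'n) monoid_scheme \<Rightarrow> 'b set \<Rightarrow> 'b set set \<Rightarrow> ('a \<Rightarrow> 'b) \<Rightarrow> bool" where
  "quasi_isometry_of_pairs L C M G S \<P> H T \<Q> q \<longleftrightarrow>
     M \<ge> 0 \<and>
     quasi_isometry L C (carrier G) (word_dist G S) (carrier H) (word_dist H T) q \<and>
     fst ` coset_rel G \<P> H T \<Q> M q = cosets G \<P> \<and>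
     snd ` coset_rel G \<P> H T \<Q> M q = cosets H \<Q>"


section \<open>Reduced collections of subgroups\<close>

definition finite_index :: "('a, 'm) monoid_scheme \<Rightarrow> 'a set \<Rightarrow> 'a set \<Rightarrow> bool" where
  "finite_index G K P \<longleftrightarrow> finite (lcosets\<^bsub>G\<lparr>carrier := P\<rparr>\<^esub> K)"

definition commensurable :: "('a, 'm) monoid_scheme \<Rightarrow> 'a set \<Rightarrow> 'a set \<Rightarrow> bool" where
  "commensurable G P Q \<longleftrightarrow> finite_index G (P \<inter> Q) P \<and> finite_index G (P \<inter> Q) Q"

definition reduced :: "('a, 'm) monoid_scheme \<Rightarrow> 'a set set \<Rightarrow> bool" where
  "reduced G \<P> \<longleftrightarrow> (\<forall>P\<in>\<P>. \<forall>Q\<in>\<P>. \<forall>g\<in>carrier G.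
     commensurable G P ((g <#\<^bsub>G\<^esub> Q) #>\<^bsub>G\<^esub> inv\<^bsub>G\<^esub> g) \<longrightarrow> P = Q \<and> g \<in> P)"


section \<open>Simplicial graphs\<close>

text \<open>A simplicial graph is a pair of its vertex set and its set of edges, each edge being a set of
  two distinct vertices.\<close>

type_synonym 'v sgraph = "'v set \<times> 'v set set"

definition walk_betw :: "'v sgraph \<Rightarrow> 'v \<Rightarrow> 'v list \<Rightarrow> 'v \<Rightarrow> bool" where
  "walk_betw \<Gamma> u vs v \<longleftrightarrow> vs \<noteq> [] \<and> hd vs = u \<and> last vs = v \<and> set vs \<subseteq> fst \<Gamma> \<and>
     successively (\<lambda>x y. {x, y} \<in> snd \<Gamma>) vs"

definition connected_graph :: "'v sgraph \<Rightarrow> bool" where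
  "connected_graph \<Gamma> \<longleftrightarrow> (\<forall>u\<in>fst \<Gamma>. \<forall>v\<in>fst \<Gamma>. \<exists>vs. walk_betw \<Gamma> u vs v)"

text \<open>The path metric; it is only meaningful for connected graphs. A walk with \<open>n\<close> edges has
  \<open>n + 1\<close> vertices.\<close>

definition graph_dist :: "'v sgraph \<Rightarrow> 'v \<Rightarrow> 'v \<Rightarrow> real" where
  "graph_dist \<Gamma> u v = real (LEAST n. \<exists>vs. walk_betw \<Gamma> u vs v \<and> length vs = Suc n)"

definition graph_quasi_isometry :: "'v sgraph \<Rightarrow> 'w sgraph \<Rightarrow> ('v \<Rightarrow> 'w) \<Rightarrow> bool" where
  "graph_quasi_isometry \<Gamma> \<Delta> f \<longleftrightarrow> connected_graph \<Gamma> \<and> connected_graph \<Delta> \<and>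
     (\<exists>L C. quasi_isometry L C (fst \<Gamma>) (graph_dist \<Gamma>) (fst \<Delta>) (graph_dist \<Delta>) f)"

text \<open>A circuit is given by its cyclic sequence of pairwise distinct vertices, so a circuit with
  \<open>n\<close> edges is represented by \<open>2n\<close> lists (choice of base point and direction). This does not affect
  whether a set of circuits of bounded length is finite.\<close>

definition circuit_edges :: "'v list \<Rightarrow> 'v set set" where
  "circuit_edges c = {{c ! i, c ! (Suc i mod length c)} | i. i < length c}"

definition circuit :: "'v sgraph \<Rightarrow> 'v list \<Rightarrow> bool" where
  "circuit \<Gamma> c \<longleftrightarrow> length c \<ge> 3 \<and> distinct c \<and> set c \<subseteq> fst \<Gamma> \<and> circuit_edges c \<subseteq> snd \<Gamma>"

definition fine :: "'v sgraph \<Rightarrow> bool" where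
  "fine \<Gamma> \<longleftrightarrow>
     (\<forall>n. \<forall>e\<in>snd \<Gamma>. finite {c. circuit \<Gamma> c \<and> length c \<le> n \<and> e \<in> circuit_edges c})"


section \<open>Coned-off Cayley graphs\<close>

text \<open>The vertex set is the disjoint union of \<open>G\<close> (via \<open>Inl\<close>) and the set of left cosets
  (via \<open>Inr\<close>). The condition \<open>s \<noteq> \<one>\<close> discards loops.\<close>

definition coned_off_cayley_graph ::
  "('a, 'm) monoid_scheme \<Rightarrow> 'a set set \<Rightarrow> 'a set \<Rightarrow> ('a + 'a set) sgraph" where
  "coned_off_cayley_graph G \<P> S =
     (Inl ` carrier G \<union> Inr ` cosets G \<P>,
      {{Inl g, Inl (g \<otimes>\<^bsub>G\<^esub> s)} | g s. g \<in> carrier G \<and> s \<in> S \<and> s \<noteq> \<one>\<^bsub>G\<^esub>} \<union>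
      {{Inl x, Inr A} | x A. A \<in> cosets G \<P> \<and> x \<in> A})"

text \<open>\<open>f\<close> is induced by \<open>q\<close> and \<open>R\<close> if, on the vertices of \<open>\<Gamma>\<close>, its graph is the union of \<open>q\<close> and
  \<open>R\<close>. In particular this forces \<open>R\<close> to be the graph of a function.\<close>

definition induced_map ::
  "'a set \<Rightarrow> ('a + 'a set) sgraph \<Rightarrow> ('a \<Rightarrow> 'b) \<Rightarrow> ('a set \<times> 'b set) set
     \<Rightarrow> ('a + 'a set \<Rightarrow> 'b + 'b set) \<Rightarrow> bool" where
  "induced_map X \<Gamma> q R f \<longleftrightarrow>
     {(v, f v) | v. v \<in> fst \<Gamma>} =
     {(Inl g, Inl (q g)) | g. g \<in> X} \<union> {(Inr A, Inr B) | A B. (A, B) \<in> R}"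

end

theory Submission
  imports Defs
begin

text \<open>Reducedness enters through one fact: two cosets of a reduced collection at finite Hausdorff
  distance are equal, since their stabilisers are commensurable. Hence \<open>coset_rel\<close> is a bijection
  between the sets of cosets. The induced map and a coarse inverse send edges to paths of bounded
  length, which gives the quasi-isometry.

  For fineness, it suffices that, for each coset \<open>A\<close> and \<open>x \<in> A\<close>, only finitely many \<open>y \<in> A\<close> are joined
  to \<open>x\<close> by a path of bounded length avoiding the cone vertex of \<open>A\<close>; the other vertices have finite
  degree. The induced map turns such paths into paths of bounded length that avoid the
  cone vertex of the coset corresponding to \<open>A\<close>, and \<open>q\<close> is finite-to-one.\<close>

text \<open>A cone vertex over an infinite subgroup has infinite degree, so local finiteness of the
  links in the first graph cannot be counted directly and has to be imported from the second. What
  makes the transfer possible is the choice of image for a cone edge from \<open>x\<close> to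
  \<open>A\<close>: a Cayley path from \<open>q x\<close> to a point of the coset matched with
  \<open>A\<close>, then one cone edge. This detour meets no other cone vertex, so injectivity of
  the matching is enough to keep avoidance of a cone vertex under the induced map.

  Commensurability comes from a pigeonhole argument: if \<open>P\<close> and a translate
  \<open>cQ\<close> are at bounded distance, the displacements between nearby points lie in a ball
  of the word metric, which is finite.

  The generating sets that measure \<open>q\<close> and those that define the graphs may differ. The
  estimates are therefore phrased as being joined by at most \<open>k\<close> steps, a notion that
  survives a change of generators up to a factor; real-valued distances appear only where the
  hypothesis is read and where the quasi-isometry is stated.\<close>

section \<open>Bounded reachability\<close>

text \<open>Word metrics and path metrics are both least step counts of a relation. Working with
  upper bounds on step counts turns the triangle inequality into composition of relations, with no
  \<open>LEAST\<close> to handle.\<close>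

definition reach :: "('x \<times> 'x) set \<Rightarrow> nat \<Rightarrow> ('x \<times> 'x) set" where
  "reach R k = (\<Union>i\<le>k. R ^^ i)"

text \<open>The \<open>LEAST\<close> is meaningful only if some power of \<open>R\<close> joins the
  points; hence the assumptions about \<open>R\<^sup>*\<close> wherever a bound on this value is
  turned back into a path.\<close>

definition rel_dist :: "('x \<times> 'x) set \<Rightarrow> 'x \<Rightarrow> 'x \<Rightarrow> real" where
  "rel_dist R x y = real (LEAST n. (x, y) \<in> R ^^ n)"

lemma reachI: "(x, y) \<in> R ^^ i \<Longrightarrow> i \<le> k \<Longrightarrow> (x, y) \<in> reach R k"
  by (auto simp: reach_def)

lemma reachE:
  assumes "(x, y) \<in> reach R k"
  obtains i where "i \<le> k" "(x, y) \<in> R ^^ i"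
  using assms by (auto simp: reach_def)

lemma reach_refl: "(x, x) \<in> reach R k"
  by (rule reachI[where i = 0]) auto

lemma reach_edge: "(x, y) \<in> R \<Longrightarrow> 0 < k \<Longrightarrow> (x, y) \<in> reach R k"
  by (rule reachI[where i = 1]) auto

lemma reach_mono: "(x, y) \<in> reach R i \<Longrightarrow> i \<le> j \<Longrightarrow> (x, y) \<in> reach R j"
  by (auto simp: reach_def)

lemma reach_trans:
  assumes "(x, y) \<in> reach R i" "(y, z) \<in> reach R j"
  shows "(x, z) \<in> reach R (i + j)"
proof -
  obtain a b where "a \<le> i" "(x, y) \<in> R ^^ a" "b \<le> j" "(y, z) \<in> R ^^ b"
    using assms by (auto elim!: reachE)
  then show ?thesis
    by (intro reachI[where i = "a + b"] relpow_trans) auto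
qed

lemma sym_relpow: "sym R \<Longrightarrow> sym (R ^^ n)"
proof (induction n)
  case 0
  then show ?case by (auto simp: sym_def)
next
  case (Suc n)
  show ?case
  proof (rule symI)
    fix x y assume "(x, y) \<in> R ^^ Suc n"
    then obtain z where "(x, z) \<in> R ^^ n" "(z, y) \<in> R" by auto
    then show "(y, x) \<in> R ^^ Suc n"
      using Suc by (meson relpow_Suc_I2 symD)
  qed
qed

lemma reach_sym: "sym R \<Longrightarrow> (x, y) \<in> reach R k \<Longrightarrow> (y, x) \<in> reach R k"
  by (meson reachE reachI symD sym_relpow)

lemma relpow_map:
  assumes "\<And>x y. (x, y) \<in> R \<Longrightarrow> (f x, f y) \<in> reach R' K"
  shows "(x, y) \<in> R ^^ n \<Longrightarrow> (f x, f y) \<in> reach R' (n * K)"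
proof (induction n arbitrary: y)
  case 0
  then show ?case by (auto intro: reach_refl)
next
  case (Suc n)
  then obtain z where "(x, z) \<in> R ^^ n" "(z, y) \<in> R" by auto
  then show ?case
    using reach_trans[OF Suc.IH assms] by (simp add: add.commute)
qed

lemma reach_map:
  assumes "\<And>x y. (x, y) \<in> R \<Longrightarrow> (f x, f y) \<in> reach R' K" "(x, y) \<in> reach R n"
  shows "(f x, f y) \<in> reach R' (n * K)"
proof -
  obtain i where i: "i \<le> n" "(x, y) \<in> R ^^ i" using assms(2) by (rule reachE)
  from relpow_map[of R f R' K, OF assms(1) i(2)] show ?thesis
    using i(1) by (auto intro: reach_mono)
qed

lemma finite_reach:
  assumes "\<And>x. finite (R `` {x})"
  shows "finite (reach R k `` {x})"
proof -
  have "finite ((R ^^ i) `` {x})" for i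
  proof (induction i)
    case 0
    show ?case by (rule finite_subset[of _ "{x}"]) auto
  next
    case (Suc i)
    have "(R ^^ Suc i) `` {x} = (\<Union>y\<in>(R ^^ i) `` {x}. R `` {y})" by auto
    then show ?case using Suc assms by simp
  qed
  then have "finite (\<Union>i\<le>k. (R ^^ i) `` {x})" by simp
  moreover have "reach R k `` {x} = (\<Union>i\<le>k. (R ^^ i) `` {x})" by (auto simp: reach_def)
  ultimately show ?thesis by simp
qed

lemma rel_dist_le: "(x, y) \<in> reach R k \<Longrightarrow> rel_dist R x y \<le> real k"
  unfolding rel_dist_def by (meson reachE Least_le of_nat_mono order_trans)

lemma relpow_rel_dist:
  assumes "(x, y) \<in> R\<^sup>*"
  obtains n where "(x, y) \<in> R ^^ n" "rel_dist R x y = real n"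
  unfolding rel_dist_def using LeastI_ex[OF rtrancl_imp_relpow[OF assms]] by blast

lemma reach_rel_dist:
  assumes "(x, y) \<in> R\<^sup>*" "rel_dist R x y \<le> r"
  shows "(x, y) \<in> reach R (nat \<lceil>r\<rceil>)"
proof -
  obtain n where n: "(x, y) \<in> R ^^ n" "rel_dist R x y = real n"
    using assms(1) by (rule relpow_rel_dist)
  then have "n \<le> nat \<lceil>r\<rceil>" using assms(2) by linarith
  with n show ?thesis by (blast intro: reachI)
qed

text \<open>A path maps edge by edge under \<open>f\<close>, which gives the upper bound. For the
  lower bound, a shortest path from \<open>f x\<close> to \<open>f x'\<close> is pulled back by
  \<open>g\<close>, and its two ends are moved to \<open>x\<close> and \<open>x'\<close> by
  \<open>gf\<close>.\<close>

lemma quasi_isometry_rel_distI: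
  fixes K :: nat
  assumes "f \<in> X \<rightarrow> Y" "g \<in> Y \<rightarrow> X" "sym R"
    and connX: "\<And>x x'. x \<in> X \<Longrightarrow> x' \<in> X \<Longrightarrow> (x, x') \<in> R\<^sup>*"
    and connY: "\<And>y y'. y \<in> Y \<Longrightarrow> y' \<in> Y \<Longrightarrow> (y, y') \<in> R'\<^sup>*"
    and f: "\<And>x y. (x, y) \<in> R \<Longrightarrow> (f x, f y) \<in> reach R' K"
    and g: "\<And>x y. (x, y) \<in> R' \<Longrightarrow> (g x, g y) \<in> reach R K"
    and gf: "\<And>x. x \<in> X \<Longrightarrow> (g (f x), x) \<in> reach R K"
    and fg: "\<And>y. y \<in> Y \<Longrightarrow> (f (g y), y) \<in> reach R' K"
    and K: "1 \<le> K"
  shows "quasi_isometry (real K) (2 * real K) X (rel_dist R) Y (rel_dist R') f"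
  unfolding quasi_isometry_def
proof (intro conjI ballI)
  show "1 \<le> real K" "0 \<le> 2 * real K" "f \<in> X \<rightarrow> Y" using K assms(1) by auto
next
  fix x x' assume x: "x \<in> X" "x' \<in> X"
  obtain n where n: "(x, x') \<in> R ^^ n" "rel_dist R x x' = real n"
    using connX[OF x] by (rule relpow_rel_dist)
  obtain m where m: "(f x, f x') \<in> R' ^^ m" "rel_dist R' (f x) (f x') = real m"
    using connY[of "f x" "f x'"] assms(1) x by (auto elim: relpow_rel_dist)
  have "rel_dist R' (f x) (f x') \<le> real (n * K)"
    using relpow_map[of R f R' K, OF f n(1)] by (rule rel_dist_le)
  then show "rel_dist R' (f x) (f x') \<le> real K * rel_dist R x x' + 2 * real K"
    using n(2) by (simp add: mult.commute)
  have "(x, x') \<in> reach R (K + m * K + K)"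
    using reach_trans[OF reach_trans[OF reach_sym[OF assms(3) gf[OF x(1)]]
          relpow_map[of R' g R K, OF g m(1)]] gf[OF x(2)]] .
  then have "rel_dist R x x' \<le> real (K + m * K + K)" by (rule rel_dist_le)
  \<comment> \<open>As \<open>K\<close> is at least 1, the two end corrections of total length
    \<open>2 * K\<close> are at most \<open>2 * K * K\<close>; division by \<open>K\<close> then
    leaves the additive constant \<open>2 * K\<close>.\<close>
  also have "\<dots> \<le> real K * (real m + 2 * real K)" using K by (simp add: algebra_simps)
  finally have "rel_dist R x x' / real K \<le> real m + 2 * real K"
    using K by (simp add: divide_le_eq mult.commute)
  then show "rel_dist R x x' / real K - 2 * real K \<le> rel_dist R' (f x) (f x')"
    using m(2) by simp
next
  fix y assume y: "y \<in> Y"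
  have "rel_dist R' (f (g y)) y \<le> 2 * real K"
    using rel_dist_le[OF fg[OF y]] by linarith
  then show "\<exists>x\<in>X. rel_dist R' (f x) y \<le> 2 * real K" using assms(2) y by blast
qed


section \<open>Graphs\<close>

definition edge_rel :: "'v sgraph \<Rightarrow> ('v \<times> 'v) set" where
  "edge_rel \<Gamma> = {(x, y). x \<in> fst \<Gamma> \<and> y \<in> fst \<Gamma> \<and> {x, y} \<in> snd \<Gamma>}"

lemma sym_edge_rel: "sym (edge_rel \<Gamma>)"
  by (auto simp: sym_def edge_rel_def insert_commute)

lemma walk_betw_Cons:
  "walk_betw \<Gamma> u (x # y # vs) v \<longleftrightarrow> u = x \<and> (x, y) \<in> edge_rel \<Gamma> \<and> walk_betw \<Gamma> y (y # vs) v"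
  by (auto simp: walk_betw_def edge_rel_def)

text \<open>The clause \<open>u \<in> fst \<Gamma>\<close> matters for \<open>n = 0\<close>: the
  zeroth power is the identity on the whole type, whereas a walk with one vertex must stay in the
  graph.\<close>

lemma relpow_edge_rel_iff:
  "(\<exists>vs. walk_betw \<Gamma> u vs v \<and> length vs = Suc n) \<longleftrightarrow> u \<in> fst \<Gamma> \<and> (u, v) \<in> edge_rel \<Gamma> ^^ n"
proof (induction n arbitrary: u)
  case 0
  have "walk_betw \<Gamma> u vs v \<and> length vs = Suc 0 \<longleftrightarrow> vs = [u] \<and> u = v \<and> u \<in> fst \<Gamma>" for vs
    by (cases vs) (auto simp: walk_betw_def)
  then show ?case by auto
next
  case (Suc n)
  show ?case
  proof
    assume "\<exists>vs. walk_betw \<Gamma> u vs v \<and> length vs = Suc (Suc n)"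
    then obtain y vs where "(u, y) \<in> edge_rel \<Gamma>" "walk_betw \<Gamma> y (y # vs) v" "length vs = n"
      by (auto simp: length_Suc_conv walk_betw_Cons)
    moreover from this have "(y, v) \<in> edge_rel \<Gamma> ^^ n"
      using Suc.IH[of y] by (metis length_Cons)
    ultimately show "u \<in> fst \<Gamma> \<and> (u, v) \<in> edge_rel \<Gamma> ^^ Suc n"
      by (auto simp: edge_rel_def intro: relpow_Suc_I2 simp del: relpow.simps)
  next
    assume "u \<in> fst \<Gamma> \<and> (u, v) \<in> edge_rel \<Gamma> ^^ Suc n"
    then obtain y where y: "(u, y) \<in> edge_rel \<Gamma>" "(y, v) \<in> edge_rel \<Gamma> ^^ n"
      using relpow_Suc_D2 by metis
    then have "y \<in> fst \<Gamma>" by (simp add: edge_rel_def)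
    then obtain vs where vs: "walk_betw \<Gamma> y vs v" "length vs = Suc n"
      using Suc.IH[of y] y(2) by blast
    then obtain ws where "vs = y # ws"
      by (cases vs) (auto simp: walk_betw_def)
    then have "walk_betw \<Gamma> u (u # vs) v" using vs(1) y(1) by (simp add: walk_betw_Cons)
    then show "\<exists>vs. walk_betw \<Gamma> u vs v \<and> length vs = Suc (Suc n)"
      using vs(2) by (intro exI[of _ "u # vs"]) simp
  qed
qed

lemma graph_dist_eq_rel_dist: "u \<in> fst \<Gamma> \<Longrightarrow> graph_dist \<Gamma> u v = rel_dist (edge_rel \<Gamma>) u v"
  unfolding graph_dist_def rel_dist_def relpow_edge_rel_iff by simp

lemma connected_graphI:
  assumes "\<And>u v. u \<in> fst \<Gamma> \<Longrightarrow> v \<in> fst \<Gamma> \<Longrightarrow> (u, v) \<in> (edge_rel \<Gamma>)\<^sup>*"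
  shows "connected_graph \<Gamma>"
  unfolding connected_graph_def
proof (intro ballI)
  fix u v assume uv: "u \<in> fst \<Gamma>" "v \<in> fst \<Gamma>"
  obtain n where "(u, v) \<in> edge_rel \<Gamma> ^^ n" using assms[OF uv] rtrancl_imp_relpow by blast
  then show "\<exists>vs. walk_betw \<Gamma> u vs v" using relpow_edge_rel_iff[of \<Gamma> u v n] uv by blast
qed

section \<open>Circuits and fineness\<close>

lemma distinct_walk:
  assumes "walk_betw \<Gamma> u vs v"
  shows "\<exists>ws. walk_betw \<Gamma> u ws v \<and> distinct ws \<and> length ws \<le> length vs"
  using assms
proof (induction "length vs" arbitrary: vs rule: less_induct)
  case less
  show ?case
  proof (cases "distinct vs")
    case True
    then show ?thesis using less.prems by auto
  next
    case False
    \<comment> \<open>Cutting out the closed piece between two visits of \<open>y\<close> gives a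
      strictly shorter walk with the same ends.\<close>
    then obtain xs y ys zs where vs: "vs = xs @ [y] @ ys @ [y] @ zs"
      using not_distinct_decomp by blast
    then have "walk_betw \<Gamma> u (xs @ [y] @ zs) v"
      using less.prems
      by (auto simp: walk_betw_def successively_append_iff successively_Cons hd_append
          split: if_splits)
    moreover have len: "length (xs @ [y] @ zs) < length vs" using vs by simp
    ultimately obtain ws where "walk_betw \<Gamma> u ws v" "distinct ws" "length ws \<le> length (xs @ [y] @ zs)"
      using less.hyps by blast
    then show ?thesis using len by (intro exI[of _ ws]) simp
  qed
qed

text \<open>The cyclic indexing modulo the length separates into consecutive pairs and one closing
  edge, so that circuits can be compared with walks.\<close>

lemma circuit_edges_subset_iff:
  assumes "c \<noteq> []"
  shows "circuit_edges c \<subseteq> E \<longleftrightarrow> successively (\<lambda>x y. {x, y} \<in> E) c \<and> {last c, hd c} \<in> E"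
proof -
  have "circuit_edges c \<subseteq> E \<longleftrightarrow> (\<forall>i<length c. {c ! i, c ! (Suc i mod length c)} \<in> E)"
    by (auto simp: circuit_edges_def)
  also have "\<dots> \<longleftrightarrow> (\<forall>i. Suc i < length c \<longrightarrow> {c ! i, c ! Suc i} \<in> E) \<and> {last c, hd c} \<in> E"
    (is "?l \<longleftrightarrow> ?r")
  proof
    assume l: ?l
    have "{c ! i, c ! Suc i} \<in> E" if "Suc i < length c" for i
      using l[rule_format, of i] that by simp
    moreover have "{last c, hd c} \<in> E"
      using l[rule_format, of "length c - 1"] assms by (simp add: last_conv_nth hd_conv_nth)
    ultimately show ?r by blast
  next
    assume r: ?r
    show ?l
    proof (intro allI impI)
      fix i assume "i < length c"
      then consider "Suc i < length c" | "Suc i = length c" by linarith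
      then show "{c ! i, c ! (Suc i mod length c)} \<in> E"
      proof cases
        case 1
        then show ?thesis using r by simp
      next
        case 2
        then have "i = length c - 1" by simp
        then show ?thesis using r 2 assms by (simp add: last_conv_nth hd_conv_nth)
      qed
    qed
  qed
  also have "(\<forall>i. Suc i < length c \<longrightarrow> {c ! i, c ! Suc i} \<in> E) \<longleftrightarrow>
      successively (\<lambda>x y. {x, y} \<in> E) c"
    by (simp add: successively_conv_nth)
  finally show ?thesis .
qed

lemma circuit_edges_rotate: "circuit_edges (rotate k c) \<subseteq> circuit_edges c"
proof
  fix e assume "e \<in> circuit_edges (rotate k c)"
  then obtain i where i: "i < length c"
    "e = {rotate k c ! i, rotate k c ! (Suc i mod length c)}"
    by (auto simp: circuit_edges_def)
  then have pos: "0 < length c" by linarith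
  let ?j = "(k + i) mod length c"
  have "e = {c ! ?j, c ! (Suc ?j mod length c)}"
    using i pos by (simp add: nth_rotate mod_simps)
  then show "e \<in> circuit_edges c" using pos unfolding circuit_edges_def by force
qed

lemma circuit_rotate: "circuit \<Gamma> c \<Longrightarrow> circuit \<Gamma> (rotate k c)"
  using circuit_edges_rotate[of k c] by (auto simp: circuit_def)

text \<open>This says that the angle metric on the link of each vertex of a fine graph is locally finite.\<close>

lemma fine_finite_link:
  assumes "fine \<Gamma>" "v \<in> fst \<Gamma>" "{v, x} \<in> snd \<Gamma>"
  shows "finite {y. {v, y} \<in> snd \<Gamma> \<and> (x, y) \<in> reach (edge_rel (fst \<Gamma> - {v}, snd \<Gamma>)) n}"
    (is "finite ?Y")
proof -
  let ?\<Delta> = "(fst \<Gamma> - {v}, snd \<Gamma>)"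
  let ?D = "{c. circuit \<Gamma> c \<and> length c \<le> n + 2 \<and> {v, x} \<in> circuit_edges c}"
  \<comment> \<open>A simple path from \<open>x\<close> to \<open>y\<close> that avoids
    \<open>v\<close> closes up at \<open>v\<close> to a circuit through \<open>{v, x}\<close> whose
    list ends in \<open>y\<close>. It has at most \<open>n + 1\<close> vertices besides
    \<open>v\<close>, hence the bound \<open>n + 2\<close>. For \<open>y = x\<close> the path could
    be trivial and would close up to only two vertices.\<close>
  have "y \<in> insert x (last ` ?D)" if y: "y \<in> ?Y" for y
  proof (cases "y = x")
    case True
    then show ?thesis by simp
  next
    case False
    obtain i where i: "i \<le> n" "(x, y) \<in> edge_rel ?\<Delta> ^^ i" using y by (auto elim: reachE)
    \<comment> \<open>That \<open>x\<close> is a vertex other than \<open>v\<close> is read off from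
      the first edge of the path, which exists because \<open>y\<close> differs from
      \<open>x\<close>.\<close>
    have "x \<in> fst ?\<Delta>"
    proof (cases i)
      case 0
      then show ?thesis using i(2) False by simp
    next
      case (Suc j)
      then show ?thesis using relpow_Suc_D2 i(2) by (fastforce simp: edge_rel_def)
    qed
    then obtain vs where "walk_betw ?\<Delta> x vs y" "length vs = Suc i"
      using i(2) relpow_edge_rel_iff by metis
    then obtain ws where ws: "walk_betw ?\<Delta> x ws y" "distinct ws" "length ws \<le> Suc i"
      using distinct_walk by fastforce
    have hl: "ws \<noteq> []" "hd ws = x" "last ws = y" using ws(1) by (auto simp: walk_betw_def)
    have len: "length ws \<ge> 2"
      using hl False by (cases ws; cases "tl ws") auto
    let ?c = "v # ws"
    have "successively (\<lambda>x y. {x, y} \<in> snd \<Gamma>) ?c" "{last ?c, hd ?c} \<in> snd \<Gamma>"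
      using ws(1) hl assms(3) y by (auto simp: successively_Cons walk_betw_def insert_commute)
    then have "circuit_edges ?c \<subseteq> snd \<Gamma>" by (subst circuit_edges_subset_iff) auto
    moreover have "set ?c \<subseteq> fst \<Gamma>" "distinct ?c"
      using ws assms(2) by (auto simp: walk_betw_def)
    ultimately have "circuit \<Gamma> ?c" using len by (simp add: circuit_def)
    moreover have "{v, x} \<in> circuit_edges ?c"
      unfolding circuit_edges_def using hl len
      by (auto intro!: exI[of _ 0] simp: hd_conv_nth)
    moreover have "length ?c \<le> n + 2" using ws(3) i(1) by simp
    ultimately show ?thesis using hl by (auto intro!: image_eqI[of _ _ ?c])
  qed
  then have "?Y \<subseteq> insert x (last ` ?D)" by blast
  moreover have "finite (insert x (last ` ?D))" using assms(1,3) by (simp add: fine_def)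
  ultimately show ?thesis by (rule finite_subset)
qed

text \<open>A circuit can be written down vertex by vertex. If any two consecutive vertices leave
  finitely many choices for the next one, then a first edge and a length bound leave finitely many
  circuits. Looking only at the first three entries loses nothing, since circuits may be
  rotated.\<close>

lemma fineI:
  assumes fin: "\<And>n u v. finite {w. \<exists>c. circuit \<Gamma> c \<and> length c \<le> n \<and> c ! 0 = u \<and> c ! 1 = v \<and> c ! 2 = w}"
    (is "\<And>n u v. finite (?N n u v)")
  shows "fine \<Gamma>"
  unfolding fine_def
proof (intro allI ballI)
  fix n e
  define D where "D u v = {c. circuit \<Gamma> c \<and> length c \<le> n \<and> c ! 0 = u \<and> c ! 1 = v}" for u v
  have next_vertex: "c ! (k + 2) \<in> ?N n (c ! k) (c ! (k + 1))"
    if "circuit \<Gamma> c" "length c \<le> n" "k + 2 < length c" for c k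
  proof -
    have "circuit \<Gamma> (rotate k c)" using that by (simp add: circuit_rotate)
    moreover have "rotate k c ! i = c ! (k + i)" if "i \<le> 2" for i
      using \<open>k + 2 < length c\<close> that by (simp add: nth_rotate)
    ultimately show ?thesis
      using that by (auto intro!: exI[of _ "rotate k c"])
  qed
  have "finite (take (m + 2) ` D u v)" for m u v
  proof (induction m)
    case 0
    have "take 2 c = [u, v]" if "c \<in> D u v" for c
      using that by (cases c; cases "tl c") (auto simp: D_def circuit_def)
    then have "take (0 + 2) ` D u v \<subseteq> {[u, v]}" unfolding add_0 by blast
    then show ?case by (rule finite_subset) simp
  next
    case (Suc m)
    \<comment> \<open>A prefix of \<open>m + 2\<close> vertices either gains one admissible vertex
      or is already the whole circuit; the latter case is the element \<open>l\<close> added by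
      \<open>insert\<close>.\<close>
    have "take (Suc m + 2) ` D u v \<subseteq> (\<Union>l\<in>take (m + 2) ` D u v.
        insert l ((\<lambda>w. l @ [w]) ` ?N n (l ! m) (l ! (m + 1))))"
    proof clarify
      fix c assume c: "c \<in> D u v"
      show "take (Suc m + 2) c \<in> (\<Union>l\<in>take (m + 2) ` D u v.
          insert l ((\<lambda>w. l @ [w]) ` ?N n (l ! m) (l ! (m + 1))))"
      proof (cases "m + 2 < length c")
        case True
        then have "take (Suc m + 2) c = take (m + 2) c @ [c ! (m + 2)]"
          by (simp add: take_Suc_conv_app_nth)
        moreover have "c ! (m + 2) \<in> ?N n (take (m + 2) c ! m) (take (m + 2) c ! (m + 1))"
          using next_vertex[of c m] True c by (simp add: D_def)
        ultimately show ?thesis using c by blast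
      next
        case False
        then have "take (Suc m + 2) c = take (m + 2) c" by simp
        then show ?thesis using c by blast
      qed
    qed
    moreover have "finite \<dots>" using Suc fin by (intro finite_UN_I) auto
    ultimately show ?case by (rule finite_subset)
  qed
  from this[of n] have finD: "finite (D u v)" for u v
  proof -
    have "take (n + 2) c = c" if "c \<in> D u v" for c using that by (simp add: D_def)
    then have "D u v \<subseteq> take (n + 2) ` D u v" by force
    then show ?thesis using \<open>finite (take (n + 2) ` D u v)\<close> by (rule finite_subset)
  qed
  show "finite {c. circuit \<Gamma> c \<and> length c \<le> n \<and> e \<in> circuit_edges c}"
  proof (cases "\<exists>x y. e = {x, y}")
    case False
    then have "{c. circuit \<Gamma> c \<and> length c \<le> n \<and> e \<in> circuit_edges c} = {}"
      by (auto simp: circuit_edges_def)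
    then show ?thesis by (metis finite.emptyI)
  next
    case True
    then obtain x y where e: "e = {x, y}" by blast
    \<comment> \<open>Rotating to the position of \<open>e\<close> produces a circuit that starts
      with \<open>x, y\<close> or with \<open>y, x\<close>; a further rotation by at most
      \<open>n\<close> undoes this.\<close>
    have "c \<in> (\<Union>j\<le>n. rotate j ` (D x y \<union> D y x))"
      if c: "circuit \<Gamma> c" "length c \<le> n" "e \<in> circuit_edges c" for c
    proof -
      obtain i where i: "i < length c" "e = {c ! i, c ! (Suc i mod length c)}"
        using c(3) by (auto simp: circuit_edges_def)
      have len: "3 \<le> length c" using c(1) by (simp add: circuit_def)
      have "rotate i c ! 0 = c ! i" "rotate i c ! 1 = c ! (Suc i mod length c)"
        using i(1) len nth_rotate[of 0 c i] nth_rotate[of 1 c i] by (fastforce, fastforce)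
      then have "rotate i c \<in> D x y \<union> D y x"
        using e i(2) c(1,2) by (auto simp: D_def circuit_rotate doubleton_eq_iff)
      moreover have "c = rotate (length c - i) (rotate i c)"
        using i(1) by (simp add: rotate_rotate)
      ultimately show ?thesis using c(2) by (intro UN_I[of "length c - i"]) auto
    qed
    then have "{c. circuit \<Gamma> c \<and> length c \<le> n \<and> e \<in> circuit_edges c} \<subseteq>
        (\<Union>j\<le>n. rotate j ` (D x y \<union> D y x))" by blast
    then show ?thesis by (rule finite_subset) (simp add: finD)
  qed
qed

text \<open>Deleting the second vertex opens the circuit to a path from the third vertex round to
  the first, with \<open>length c - 2\<close> edges. Distinctness guarantees that this path avoids
  the deleted vertex.\<close>

lemma circuit_next_vertex:
  assumes "circuit \<Gamma> c" "length c \<le> n"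
  shows "(c ! 2, c ! 0) \<in> reach (edge_rel (fst \<Gamma> - {c ! 1}, snd \<Gamma>)) n"
    and "(c ! 0, c ! 1) \<in> edge_rel \<Gamma>" and "(c ! 1, c ! 2) \<in> edge_rel \<Gamma>"
proof -
  obtain u v w vs where c: "c = u # v # w # vs"
    using assms(1) by (cases c; cases "tl c"; cases "tl (tl c)") (auto simp: circuit_def)
  have "circuit_edges c \<subseteq> snd \<Gamma>" using assms(1) by (simp add: circuit_def)
  then have E: "successively (\<lambda>x y. {x, y} \<in> snd \<Gamma>) c" "{last c, hd c} \<in> snd \<Gamma>"
    using circuit_edges_subset_iff[of c] c by auto
  have dist: "distinct c" "set c \<subseteq> fst \<Gamma>" using assms(1) by (auto simp: circuit_def)
  have "successively (\<lambda>x y. {x, y} \<in> snd \<Gamma>) ((w # vs) @ [u])"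
    unfolding successively_append_iff using E c by simp
  then have "walk_betw (fst \<Gamma> - {v}, snd \<Gamma>) w ((w # vs) @ [u]) u"
    using dist c by (auto simp: walk_betw_def)
  then have "(w, u) \<in> edge_rel (fst \<Gamma> - {v}, snd \<Gamma>) ^^ Suc (length vs)"
    using relpow_edge_rel_iff[of "(fst \<Gamma> - {v}, snd \<Gamma>)" w u "Suc (length vs)"] by auto
  then have "(w, u) \<in> reach (edge_rel (fst \<Gamma> - {v}, snd \<Gamma>)) n"
    by (rule reachI) (use assms(2) c in simp)
  then show "(c ! 2, c ! 0) \<in> reach (edge_rel (fst \<Gamma> - {c ! 1}, snd \<Gamma>)) n"
    using c by simp
  show "(c ! 0, c ! 1) \<in> edge_rel \<Gamma>" "(c ! 1, c ! 2) \<in> edge_rel \<Gamma>"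
    using E(1) dist c by (auto simp: edge_rel_def)
qed


section \<open>Cayley graphs\<close>

text \<open>Loops are kept, unlike in the coned-off graph, so that the \<open>n\<close>-th power
  corresponds exactly to the words of length \<open>n\<close> in \<open>word_dist\<close>, in which
  the letter one may occur.\<close>

definition Cay :: "('a, 'm) monoid_scheme \<Rightarrow> 'a set \<Rightarrow> ('a \<times> 'a) set" where
  "Cay G S = {(g, g \<otimes>\<^bsub>G\<^esub> s) | g s. g \<in> carrier G \<and> s \<in> S \<union> m_inv G ` S}"

lemma CayE:
  assumes "(x, y) \<in> Cay G S"
  obtains s where "x \<in> carrier G" "y = x \<otimes>\<^bsub>G\<^esub> s" "s \<in> S \<union> m_inv G ` S"
  using assms unfolding Cay_def by blast

context group
begin

lemma Cay_carrier:
  "S \<subseteq> carrier G \<Longrightarrow> (x, y) \<in> Cay G S \<Longrightarrow> x \<in> carrier G \<and> y \<in> carrier G"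
  by (auto simp: Cay_def)

lemma sym_Cay:
  assumes S: "S \<subseteq> carrier G"
  shows "sym (Cay G S)"
proof (rule symI)
  fix x y assume "(x, y) \<in> Cay G S"
  then obtain s where s: "x \<in> carrier G" "y = x \<otimes> s" "s \<in> S \<union> m_inv G ` S"
    by (rule CayE)
  have sc: "s \<in> carrier G" using s(3) S by auto
  have "inv s \<in> S \<union> m_inv G ` S"
    using s(3)
  proof
    assume "s \<in> m_inv G ` S"
    then obtain t where "t \<in> S" "s = inv t" by blast
    then show ?thesis using S by (simp add: subset_iff)
  qed simp
  moreover have "x = y \<otimes> inv s" using s sc by (simp add: m_assoc)
  moreover have "y \<in> carrier G" using s sc by simp
  ultimately show "(y, x) \<in> Cay G S" unfolding Cay_def by blast
qed

lemma Cay_mult_left: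
  assumes "S \<subseteq> carrier G" "g \<in> carrier G" "(x, y) \<in> Cay G S"
  shows "(g \<otimes> x, g \<otimes> y) \<in> Cay G S"
proof -
  obtain s where s: "x \<in> carrier G" "y = x \<otimes> s" "s \<in> S \<union> m_inv G ` S"
    using assms(3) by (rule CayE)
  then have "s \<in> carrier G" using assms(1) by auto
  then have "g \<otimes> y = (g \<otimes> x) \<otimes> s" using s assms(2) by (simp add: m_assoc)
  then show ?thesis using s assms(2) by (auto simp: Cay_def)
qed

lemma reach_Cay_mult_left:
  assumes "S \<subseteq> carrier G" "g \<in> carrier G" "(x, y) \<in> reach (Cay G S) k"
  shows "(g \<otimes> x, g \<otimes> y) \<in> reach (Cay G S) k"
  using reach_map[of "Cay G S" "(\<otimes>) g" "Cay G S" 1 x y k] Cay_mult_left[OF assms(1,2)] assms(3)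
  by (simp add: reach_edge)

lemma Cay_connected:
  assumes "finite_generating_set G S" "x \<in> carrier G" "y \<in> carrier G"
  shows "(x, y) \<in> (Cay G S)\<^sup>*"
proof -
  have S: "S \<subseteq> carrier G" "generate G S = carrier G"
    using assms(1) by (auto simp: finite_generating_set_def)
  \<comment> \<open>The base point is quantified inside the induction because the second factor of a
    product is traversed from \<open>g \<otimes> h1\<close>, not from \<open>g\<close>.\<close>
  have "\<forall>g\<in>carrier G. (g, g \<otimes> z) \<in> (Cay G S)\<^sup>*" if "z \<in> generate G S" for z
    using that
  proof induction
    case one
    then show ?case by simp
  next
    case (incl h)
    then show ?case by (auto simp: Cay_def)
  next
    case (inv h)
    then show ?case by (auto simp: Cay_def)
  next
    case (eng h1 h2)
    then have h: "h1 \<in> carrier G" "h2 \<in> carrier G" using S by auto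
    show ?case
    proof
      fix g assume g: "g \<in> carrier G"
      have "(g, g \<otimes> h1) \<in> (Cay G S)\<^sup>*" "(g \<otimes> h1, g \<otimes> h1 \<otimes> h2) \<in> (Cay G S)\<^sup>*"
        using eng.IH g h by auto
      then show "(g, g \<otimes> (h1 \<otimes> h2)) \<in> (Cay G S)\<^sup>*"
        using g h by (simp add: m_assoc)
    qed
  qed
  then have "(x, x \<otimes> (inv x \<otimes> y)) \<in> (Cay G S)\<^sup>*" using assms(2,3) S(2) by auto
  then show ?thesis using assms(2,3) by (simp add: m_assoc[symmetric])
qed

text \<open>The first letter \<open>s\<close> of a word is the first step, from \<open>x\<close> to
  \<open>x \<otimes> s\<close>, and the remaining letters must represent the displacement from there
  to \<open>y\<close>; so the induction varies \<open>x\<close>.\<close>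

lemma word_eq_relpow_Cay:
  assumes S: "S \<subseteq> carrier G" and "x \<in> carrier G" and y: "y \<in> carrier G"
  shows "(\<exists>ws. length ws = n \<and> set ws \<subseteq> S \<union> m_inv G ` S \<and> foldr (\<otimes>) ws \<one> = inv x \<otimes> y) \<longleftrightarrow>
    (x, y) \<in> Cay G S ^^ n"
  using assms(2)
proof (induction n arbitrary: x)
  case 0
  have "\<one> = inv x \<otimes> y \<longleftrightarrow> x = y"
    using 0 y inv_solve_left[of \<one> x y] by auto
  then show ?case by auto
next
  case (Suc n)
  have words: "foldr (\<otimes>) ws \<one> \<in> carrier G" if "set ws \<subseteq> S \<union> m_inv G ` S" for ws
    using that S by (induction ws) auto
  have step: "s \<otimes> w = inv x \<otimes> y \<longleftrightarrow> w = inv (x \<otimes> s) \<otimes> y"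
    if "s \<in> carrier G" "w \<in> carrier G" for s w
    using that Suc.prems y
    by (metis inv_closed inv_mult_group inv_solve_left m_assoc m_closed)
  let ?T = "S \<union> m_inv G ` S"
  have T: "?T \<subseteq> carrier G" using S by auto
  show ?case
  proof
    assume "\<exists>ws. length ws = Suc n \<and> set ws \<subseteq> ?T \<and> foldr (\<otimes>) ws \<one> = inv x \<otimes> y"
    then obtain vs where vs: "length vs = Suc n" "set vs \<subseteq> ?T" "foldr (\<otimes>) vs \<one> = inv x \<otimes> y"
      by blast
    obtain s ws where "vs = s # ws" using vs(1) by (cases vs) simp_all
    then have ws: "length ws = n" "s \<in> ?T" "set ws \<subseteq> ?T" "s \<otimes> foldr (\<otimes>) ws \<one> = inv x \<otimes> y"
      using vs by simp_all
    have s: "s \<in> carrier G" using ws(2) T by blast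
    have "foldr (\<otimes>) ws \<one> = inv (x \<otimes> s) \<otimes> y"
      using ws(4) step[OF s words[OF ws(3)]] by simp
    then have "(x \<otimes> s, y) \<in> Cay G S ^^ n"
      using Suc.IH[of "x \<otimes> s"] Suc.prems s ws by blast
    moreover have "(x, x \<otimes> s) \<in> Cay G S" using ws(2) Suc.prems by (auto simp: Cay_def)
    ultimately show "(x, y) \<in> Cay G S ^^ Suc n" by (rule relpow_Suc_I2[rotated])
  next
    assume "(x, y) \<in> Cay G S ^^ Suc n"
    then obtain z where z: "(x, z) \<in> Cay G S" "(z, y) \<in> Cay G S ^^ n"
      using relpow_Suc_D2 by metis
    from z(1) obtain s where s: "z = x \<otimes> s" "s \<in> ?T" by (rule CayE)
    then have sc: "s \<in> carrier G" using T by blast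
    obtain ws where ws: "length ws = n" "set ws \<subseteq> ?T" "foldr (\<otimes>) ws \<one> = inv (x \<otimes> s) \<otimes> y"
      using Suc.IH[of "x \<otimes> s"] Suc.prems s sc z(2) by blast
    then have "foldr (\<otimes>) (s # ws) \<one> = inv x \<otimes> y"
      using step[OF sc words[OF ws(2)]] by simp
    then show "\<exists>ws. length ws = Suc n \<and> set ws \<subseteq> ?T \<and> foldr (\<otimes>) ws \<one> = inv x \<otimes> y"
      using ws s by (intro exI[of _ "s # ws"]) simp
  qed
qed

lemma word_dist_eq_rel_dist:
  "S \<subseteq> carrier G \<Longrightarrow> x \<in> carrier G \<Longrightarrow> y \<in> carrier G \<Longrightarrow> word_dist G S x y = rel_dist (Cay G S) x y"
  unfolding word_dist_def rel_dist_def by (simp add: word_eq_relpow_Cay)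

lemma finite_reach_Cay: "finite S \<Longrightarrow> finite (reach (Cay G S) k `` {x})"
proof (rule finite_reach)
  fix x assume "finite S"
  then have "finite ((\<lambda>s. x \<otimes> s) ` (S \<union> m_inv G ` S))" by simp
  then show "finite (Cay G S `` {x})" by (rule finite_subset[rotated]) (auto simp: Cay_def)
qed

text \<open>There are finitely many letters, each reached from the identity in finitely many steps
  of the new generators; \<open>c\<close> is the largest of these counts, and left translation
  carries the bound to every edge. The 0 in the \<open>Max\<close> covers an empty
  \<open>S\<close>.\<close>

lemma change_generating_set:
  assumes "finite_generating_set G S" "finite_generating_set G S'"
  obtains c where "\<And>x y k. (x, y) \<in> reach (Cay G S) k \<Longrightarrow> (x, y) \<in> reach (Cay G S') (k * c)"
proof -
  let ?T = "S \<union> m_inv G ` S"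
  have S: "finite ?T" "?T \<subseteq> carrier G" "S' \<subseteq> carrier G"
    using assms by (auto simp: finite_generating_set_def)
  have "\<forall>s\<in>?T. \<exists>k. (\<one>, s) \<in> reach (Cay G S') k"
  proof
    fix s assume "s \<in> ?T"
    then have "(\<one>, s) \<in> (Cay G S')\<^sup>*" using Cay_connected[OF assms(2), of \<one> s] S(2) by blast
    then show "\<exists>k. (\<one>, s) \<in> reach (Cay G S') k"
      by (meson rtrancl_imp_relpow reachI order_refl)
  qed
  then obtain \<kappa> where \<kappa>: "\<And>s. s \<in> ?T \<Longrightarrow> (\<one>, s) \<in> reach (Cay G S') (\<kappa> s)" by metis
  define c where "c = Max (insert 0 (\<kappa> ` ?T))"
  have edge: "(x, y) \<in> reach (Cay G S') c" if xy: "(x, y) \<in> Cay G S" for x y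
  proof -
    obtain s where s: "x \<in> carrier G" "y = x \<otimes> s" "s \<in> ?T" using xy by (rule CayE)
    have "\<kappa> s \<le> c" unfolding c_def using S(1) s(3) by (intro Max_ge) auto
    then have "(\<one>, s) \<in> reach (Cay G S') c" using \<kappa>[OF s(3)] by (rule reach_mono[rotated])
    from reach_Cay_mult_left[OF S(3) s(1) this] show ?thesis using s by simp
  qed
  show thesis by (rule that) (rule reach_map[where f = "\<lambda>x. x", OF edge])
qed


section \<open>Cosets of reduced collections\<close>

text \<open>Pigeonhole: elements with the same value of \<open>f\<close> lie in the same left coset
  of \<open>K\<close>, so there are at most as many cosets as values. Each value is represented by
  one chosen preimage.\<close>

lemma finite_indexI:
  assumes P: "subgroup P G" and K: "subgroup K G" and fin: "finite (f ` P)"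
    and f: "\<And>x y. x \<in> P \<Longrightarrow> y \<in> P \<Longrightarrow> f x = f y \<Longrightarrow> inv x \<otimes> y \<in> K"
  shows "finite_index G K P"
proof -
  have "a <# K \<in> (\<lambda>z. inv_into P f z <# K) ` f ` P" if a: "a \<in> P" for a
  proof -
    define b where "b = inv_into P f (f a)"
    have b: "b \<in> P" "f b = f a" unfolding b_def using a by (auto intro: inv_into_into f_inv_into_f)
    have c: "a \<in> carrier G" "b \<in> carrier G" using a b subgroup.mem_carrier[OF P] by auto
    have "a = b \<otimes> (inv b \<otimes> a)" using c by (simp add: m_assoc[symmetric])
    then have "a \<in> b <# K" using f[OF b(1) a b(2)] unfolding l_coset_def by blast
    then have "a <# K = b <# K" using l_repr_independence[OF _ c(2) K] by metis
    then show ?thesis using a unfolding b_def by blast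
  qed
  then have "lcosets\<^bsub>G\<lparr>carrier := P\<rparr>\<^esub> K \<subseteq> (\<lambda>z. inv_into P f z <# K) ` f ` P"
    by (auto simp: LCOSETS_def l_coset_def)
  then show ?thesis unfolding finite_index_def using fin by (meson finite_imageI finite_subset)
qed

lemma inv_mult_eqI:
  assumes "a \<in> carrier G" "b \<in> carrier G" "u \<in> carrier G" "v \<in> carrier G" "a \<otimes> u = b \<otimes> v"
  shows "inv a \<otimes> b = u \<otimes> inv v"
proof -
  have "u = inv a \<otimes> b \<otimes> v"
    using assms by (metis inv_closed inv_solve_left m_assoc m_closed)
  then show ?thesis using assms by (simp add: m_assoc)
qed

lemma subgroup_conjugate:
  assumes "subgroup Q G" "c \<in> carrier G"
  shows "subgroup ((c <# Q) #> inv c) G"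
proof -
  have Q: "Q \<subseteq> carrier G" using assms(1) by (rule subgroup.subset)
  have eq: "(c <# Q) #> inv c = (\<lambda>q. c \<otimes> q \<otimes> inv c) ` Q"
    by (auto simp: l_coset_def r_coset_def)
  show ?thesis
    unfolding eq
  proof (rule subgroupI)
    show "(\<lambda>q. c \<otimes> q \<otimes> inv c) ` Q \<subseteq> carrier G" using Q assms(2) by auto
    show "(\<lambda>q. c \<otimes> q \<otimes> inv c) ` Q \<noteq> {}" using subgroup.one_closed[OF assms(1)] by auto
  next
    fix a assume "a \<in> (\<lambda>q. c \<otimes> q \<otimes> inv c) ` Q"
    then obtain q where q: "q \<in> Q" "a = c \<otimes> q \<otimes> inv c" by blast
    then have "inv a = c \<otimes> inv q \<otimes> inv c"
      using Q assms(2) by (simp add: inv_mult_group m_assoc subset_iff)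
    then show "inv a \<in> (\<lambda>q. c \<otimes> q \<otimes> inv c) ` Q"
      using q subgroup.m_inv_closed[OF assms(1)] by blast
  next
    fix a b assume "a \<in> (\<lambda>q. c \<otimes> q \<otimes> inv c) ` Q" "b \<in> (\<lambda>q. c \<otimes> q \<otimes> inv c) ` Q"
    then obtain q r where q: "q \<in> Q" "a = c \<otimes> q \<otimes> inv c" "r \<in> Q" "b = c \<otimes> r \<otimes> inv c"
      by blast
    have qr: "q \<in> carrier G" "r \<in> carrier G" using q Q by auto
    have "inv c \<otimes> (c \<otimes> (r \<otimes> inv c)) = r \<otimes> inv c"
      using qr assms(2) by (simp add: m_assoc[symmetric])
    then have "a \<otimes> b = c \<otimes> (q \<otimes> r) \<otimes> inv c"
      using qr assms(2) q(2,4) by (simp add: m_assoc)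
    then show "a \<otimes> b \<in> (\<lambda>q. c \<otimes> q \<otimes> inv c) ` Q"
      using q subgroup.m_closed[OF assms(1)] by blast
  qed
qed

text \<open>The element \<open>inv p \<otimes> (c \<otimes> q)\<close> is the displacement from
  \<open>p\<close> to \<open>c \<otimes> q\<close>. Each element of one group is paired with a
  partner in the other so that the displacement falls in \<open>Z\<close>; two elements with equal
  displacement differ by an element of the intersection.\<close>

lemma commensurableI:
  assumes P: "subgroup P G" and Q: "subgroup Q G" and c: "c \<in> carrier G" and Z: "finite Z"
    and PQ: "\<And>p. p \<in> P \<Longrightarrow> \<exists>q\<in>Q. inv p \<otimes> (c \<otimes> q) \<in> Z"
    and QP: "\<And>q. q \<in> Q \<Longrightarrow> \<exists>p\<in>P. inv p \<otimes> (c \<otimes> q) \<in> Z"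
  shows "commensurable G P ((c <# Q) #> inv c)"
proof -
  let ?R = "(c <# Q) #> inv c"
  have R: "subgroup ?R G" using subgroup_conjugate[OF Q c] .
  have K: "subgroup (P \<inter> ?R) G" using subgroups_Inter_pair[OF P R] .
  have carr: "x \<in> carrier G" if "x \<in> P \<or> x \<in> Q \<or> x \<in> ?R" for x
    using that subgroup.mem_carrier P Q R by metis
  \<comment> \<open>The hypothesis is applied to \<open>inv x\<close> so that equality of values
    controls \<open>inv x \<otimes> y\<close>, the quantity that decides equality of left
    cosets.\<close>
  have "\<forall>x\<in>P. \<exists>q. q \<in> Q \<and> x \<otimes> (c \<otimes> q) \<in> Z"
  proof
    fix x assume x: "x \<in> P"
    then show "\<exists>q. q \<in> Q \<and> x \<otimes> (c \<otimes> q) \<in> Z"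
      using PQ[of "inv x"] carr[of x] subgroup.m_inv_closed[OF P x] by auto
  qed
  then obtain \<sigma> where \<sigma>: "\<And>x. x \<in> P \<Longrightarrow> \<sigma> x \<in> Q" "\<And>x. x \<in> P \<Longrightarrow> x \<otimes> (c \<otimes> \<sigma> x) \<in> Z"
    by metis
  have "finite_index G (P \<inter> ?R) P"
  proof (rule finite_indexI[OF P K])
    show "finite ((\<lambda>x. x \<otimes> (c \<otimes> \<sigma> x)) ` P)" using \<sigma>(2) Z by (meson finite_subset image_subsetI)
  next
    fix x y assume xy: "x \<in> P" "y \<in> P" "x \<otimes> (c \<otimes> \<sigma> x) = y \<otimes> (c \<otimes> \<sigma> y)"
    note cs = carr[of x] carr[of y] carr[of "\<sigma> x"] carr[of "\<sigma> y"] \<sigma>(1)[OF xy(1)] \<sigma>(1)[OF xy(2)]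
    have "inv x \<otimes> y = (c \<otimes> \<sigma> x) \<otimes> inv (c \<otimes> \<sigma> y)"
      using xy cs c by (intro inv_mult_eqI) auto
    also have "\<dots> = c \<otimes> (\<sigma> x \<otimes> inv (\<sigma> y)) \<otimes> inv c"
      using cs c by (simp add: inv_mult_group m_assoc)
    finally have "inv x \<otimes> y \<in> ?R"
      using subgroup.m_closed[OF Q] subgroup.m_inv_closed[OF Q] cs
      by (auto simp: l_coset_def r_coset_def)
    then show "inv x \<otimes> y \<in> P \<inter> ?R"
      using xy subgroup.m_closed[OF P] subgroup.m_inv_closed[OF P] by blast
  qed
  \<comment> \<open>For \<open>x = c \<otimes> q \<otimes> inv c\<close> the product
    \<open>inv x \<otimes> c\<close> is \<open>c \<otimes> inv q\<close>, a point of the translate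
    of \<open>Q\<close>. Equal values then give
    \<open>inv x \<otimes> y = \<pi> x \<otimes> inv (\<pi> y)\<close>, which lies in
    \<open>P\<close>.\<close>
  moreover have "\<forall>x\<in>?R. \<exists>p. p \<in> P \<and> inv p \<otimes> (inv x \<otimes> c) \<in> Z"
  proof
    fix x assume "x \<in> ?R"
    then obtain q where q: "q \<in> Q" "x = c \<otimes> q \<otimes> inv c" by (auto simp: l_coset_def r_coset_def)
    then have "inv x \<otimes> c = c \<otimes> inv q"
      using carr[of q] c by (simp add: inv_mult_group m_assoc)
    then show "\<exists>p. p \<in> P \<and> inv p \<otimes> (inv x \<otimes> c) \<in> Z"
      using QP[of "inv q"] subgroup.m_inv_closed[OF Q q(1)] by auto
  qed
  then obtain \<pi> where \<pi>: "\<And>x. x \<in> ?R \<Longrightarrow> \<pi> x \<in> P"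
    "\<And>x. x \<in> ?R \<Longrightarrow> inv (\<pi> x) \<otimes> (inv x \<otimes> c) \<in> Z" by metis
  have "finite_index G (P \<inter> ?R) ?R"
  proof (rule finite_indexI[OF R K])
    show "finite ((\<lambda>x. inv (\<pi> x) \<otimes> (inv x \<otimes> c)) ` ?R)"
      using \<pi>(2) Z by (meson finite_subset image_subsetI)
  next
    fix x y assume xy: "x \<in> ?R" "y \<in> ?R"
      "inv (\<pi> x) \<otimes> (inv x \<otimes> c) = inv (\<pi> y) \<otimes> (inv y \<otimes> c)"
    note cs = carr[of x] carr[of y] carr[of "\<pi> x"] carr[of "\<pi> y"] \<pi>(1)[OF xy(1)] \<pi>(1)[OF xy(2)]
    have "inv (inv (\<pi> x)) \<otimes> inv (\<pi> y) = (inv x \<otimes> c) \<otimes> inv (inv y \<otimes> c)"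
      using xy cs c by (intro inv_mult_eqI) auto
    also have "\<dots> = inv x \<otimes> (c \<otimes> (inv c \<otimes> y))"
      using xy cs c by (simp add: inv_mult_group m_assoc)
    also have "\<dots> = inv x \<otimes> y" using xy cs c by (simp add: m_assoc[symmetric])
    finally have "inv x \<otimes> y = \<pi> x \<otimes> inv (\<pi> y)" using cs by simp
    then have "inv x \<otimes> y \<in> P"
      using cs subgroup.m_closed[OF P] subgroup.m_inv_closed[OF P] by simp
    then show "inv x \<otimes> y \<in> P \<inter> ?R"
      using xy subgroup.m_closed[OF R] subgroup.m_inv_closed[OF R] by blast
  qed
  ultimately show ?thesis unfolding commensurable_def ..
qed

lemma cosetsE:
  assumes "A \<in> cosets G \<P>"
  obtains g P where "g \<in> carrier G" "P \<in> \<P>" "A = g <# P"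
  using assms by (auto simp: cosets_def LCOSETS_def)

lemma cosets_subset_carrier:
  assumes "\<And>P. P \<in> \<P> \<Longrightarrow> subgroup P G" "A \<in> cosets G \<P>"
  shows "A \<subseteq> carrier G"
  using assms(2) by (rule cosetsE) (metis assms(1) l_coset_subset_G subgroup.subset)

lemma cosets_nonempty:
  assumes "\<And>P. P \<in> \<P> \<Longrightarrow> subgroup P G" "A \<in> cosets G \<P>"
  obtains x where "x \<in> A"
  using assms(2) by (rule cosetsE) (metis assms(1) lcos_self)

lemma finite_cosets_containing:
  assumes "finite \<P>" "\<And>P. P \<in> \<P> \<Longrightarrow> subgroup P G"
  shows "finite {A \<in> cosets G \<P>. x \<in> A}"
proof (rule finite_subset)
  show "{A \<in> cosets G \<P>. x \<in> A} \<subseteq> (\<lambda>P. x <# P) ` \<P>"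
    using l_repr_independence assms(2) by (fastforce elim!: cosetsE)
qed (use assms(1) in simp)

lemma reduced_cosets_eqI:
  assumes red: "reduced G \<P>" and sub: "\<And>P. P \<in> \<P> \<Longrightarrow> subgroup P G"
    and S: "finite S" "S \<subseteq> carrier G"
    and A: "A \<in> cosets G \<P>" and B: "B \<in> cosets G \<P>"
    and AB: "\<And>a. a \<in> A \<Longrightarrow> \<exists>b\<in>B. (a, b) \<in> reach (Cay G S) k"
    and BA: "\<And>b. b \<in> B \<Longrightarrow> \<exists>a\<in>A. (a, b) \<in> reach (Cay G S) k"
  shows "A = B"
proof -
  obtain g P where g: "g \<in> carrier G" "P \<in> \<P>" "A = g <# P" using A by (rule cosetsE)
  obtain h Q where h: "h \<in> carrier G" "Q \<in> \<P>" "B = h <# Q" using B by (rule cosetsE)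
  \<comment> \<open>Left translation by \<open>inv g\<close> preserves the word metric and carries
    \<open>A\<close> to \<open>P\<close> and \<open>B\<close> to the translate of \<open>Q\<close>
    by \<open>c\<close>. All displacements then lie in \<open>Z\<close>, the ball of radius
    \<open>k\<close> about the identity.\<close>
  define c where "c = inv g \<otimes> h"
  define Z where "Z = reach (Cay G S) k `` {\<one>}"
  have c: "c \<in> carrier G" using g h by (simp add: c_def)
  have h_eq: "h = g \<otimes> c" using g h by (simp add: c_def m_assoc[symmetric])
  have Zmem: "inv p \<otimes> (c \<otimes> q) \<in> Z"
    if "p \<in> P" "q \<in> Q" "(g \<otimes> p, h \<otimes> q) \<in> reach (Cay G S) k" for p q
  proof -
    have pq: "p \<in> carrier G" "q \<in> carrier G" using that g h sub subgroup.mem_carrier by metis+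
    have "(inv (g \<otimes> p) \<otimes> (g \<otimes> p), inv (g \<otimes> p) \<otimes> (h \<otimes> q)) \<in> reach (Cay G S) k"
      using that pq g by (intro reach_Cay_mult_left[OF S(2)]) auto
    moreover have "inv (g \<otimes> p) \<otimes> (h \<otimes> q) = inv p \<otimes> (c \<otimes> q)"
      using pq g h c by (simp add: c_def inv_mult_group m_assoc)
    ultimately show ?thesis using pq g by (simp add: Z_def)
  qed
  have "commensurable G P ((c <# Q) #> inv c)"
  proof (rule commensurableI[of P Q c Z])
    show "finite Z" unfolding Z_def using S(1) by (rule finite_reach_Cay)
  next
    fix p assume p: "p \<in> P"
    then obtain b where "b \<in> B" "(g \<otimes> p, b) \<in> reach (Cay G S) k"
      using AB[of "g \<otimes> p"] g by (auto simp: l_coset_def)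
    then show "\<exists>q\<in>Q. inv p \<otimes> (c \<otimes> q) \<in> Z" using h Zmem p by (auto simp: l_coset_def)
  next
    fix q assume q: "q \<in> Q"
    then obtain a where "a \<in> A" "(a, h \<otimes> q) \<in> reach (Cay G S) k"
      using BA[of "h \<otimes> q"] h by (auto simp: l_coset_def)
    then show "\<exists>p\<in>P. inv p \<otimes> (c \<otimes> q) \<in> Z" using g Zmem q by (auto simp: l_coset_def)
  qed (use sub g h c in auto)
  then have "P = Q" "c \<in> P" using red g h c unfolding reduced_def by blast+
  moreover have "h \<in> g <# P" using h_eq \<open>c \<in> P\<close> by (auto simp: l_coset_def)
  ultimately show "A = B" using l_repr_independence[of h g P] g h sub by auto
qed

end


section \<open>Coned-off Cayley graphs\<close>

text \<open>Only the vertex set is reduced; since \<open>edge_rel\<close> tests both ends of an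
  edge, the edges at the removed cone vertices disappear as well.\<close>

definition cone_rel ::
  "('a, 'm) monoid_scheme \<Rightarrow> 'a set set \<Rightarrow> 'a set \<Rightarrow> 'a set set \<Rightarrow> (('a + 'a set) \<times> ('a + 'a set)) set"
where
  "cone_rel G \<P> S W = edge_rel (fst (coned_off_cayley_graph G \<P> S) - Inr ` W,
     snd (coned_off_cayley_graph G \<P> S))"

lemma fst_coned_off: "fst (coned_off_cayley_graph G \<P> S) = Inl ` carrier G \<union> Inr ` cosets G \<P>"
  by (simp add: coned_off_cayley_graph_def)

lemma cone_rel_empty: "cone_rel G \<P> S {} = edge_rel (coned_off_cayley_graph G \<P> S)"
  by (simp add: cone_rel_def)

lemma sym_cone_rel: "sym (cone_rel G \<P> S W)"
  by (simp add: cone_rel_def sym_edge_rel)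

lemma cone_relD:
  assumes "(u, v) \<in> cone_rel G \<P> S W"
  shows "(u, v) \<in> edge_rel (coned_off_cayley_graph G \<P> S)" "u \<notin> Inr ` W" "v \<notin> Inr ` W"
  using assms by (auto simp: cone_rel_def edge_rel_def)

context group
begin

lemma coned_off_edge_cases:
  assumes "S \<subseteq> carrier G" "(u, v) \<in> edge_rel (coned_off_cayley_graph G \<P> S)"
  obtains (cayley) g h where "u = Inl g" "v = Inl h" "(g, h) \<in> Cay G S"
  | (to_cone) x A where "u = Inl x" "v = Inr A" "A \<in> cosets G \<P>" "x \<in> A"
  | (from_cone) x A where "u = Inr A" "v = Inl x" "A \<in> cosets G \<P>" "x \<in> A"
proof -
  have "{u, v} \<in> snd (coned_off_cayley_graph G \<P> S)" using assms(2) by (simp add: edge_rel_def)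
  then consider g s where "{u, v} = {Inl g, Inl (g \<otimes> s)}" "g \<in> carrier G" "s \<in> S"
    | x A where "{u, v} = {Inl x, Inr A}" "A \<in> cosets G \<P>" "x \<in> A"
    unfolding coned_off_cayley_graph_def by auto
  then show thesis
  proof cases
    case (1 g s)
    then have "(g, g \<otimes> s) \<in> Cay G S" by (auto simp: Cay_def)
    moreover from this have "(g \<otimes> s, g) \<in> Cay G S" using symD[OF sym_Cay[OF assms(1)]] by blast
    ultimately show thesis using 1(1) cayley by (auto simp: doubleton_eq_iff)
  next
    case (2 x A)
    then show thesis using to_cone from_cone by (auto simp: doubleton_eq_iff)
  qed
qed

lemma cone_relI:
  assumes "\<And>P. P \<in> \<P> \<Longrightarrow> subgroup P G" "A \<in> cosets G \<P>" "A \<notin> W" "x \<in> A"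
  shows "(Inl x, Inr A) \<in> cone_rel G \<P> S W"
  using cosets_subset_carrier[of \<P> A] assms
  unfolding cone_rel_def edge_rel_def by (auto simp: coned_off_cayley_graph_def)

text \<open>At most one step, not exactly one, because \<open>Cay\<close> may contain loops.
  \<open>W\<close> is arbitrary because an edge between group elements touches no cone
  vertex.\<close>

lemma Cay_cone_rel:
  assumes "S \<subseteq> carrier G" "(x, y) \<in> Cay G S"
  shows "(Inl x, Inl y) \<in> reach (cone_rel G \<P> S W) 1"
proof (cases "x = y")
  case True
  then show ?thesis by (simp add: reach_refl)
next
  case False
  have carr: "x \<in> carrier G" "y \<in> carrier G" using Cay_carrier assms by auto
  obtain s where s: "y = x \<otimes> s" "s \<in> S \<union> m_inv G ` S" using assms(2) by (rule CayE)
  have "\<exists>g s. {Inl x, Inl y} = {Inl g, Inl (g \<otimes> s)} \<and> g \<in> carrier G \<and> s \<in> S \<and> s \<noteq> \<one>"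
    using s(2)
  proof
    assume "s \<in> S"
    moreover have "s \<noteq> \<one>" using s(1) False carr by auto
    ultimately show ?thesis using s(1) carr by blast
  next
    assume "s \<in> m_inv G ` S"
    then obtain t where t: "t \<in> S" "s = inv t" by blast
    then have "t \<in> carrier G" using assms(1) by blast
    then have "x = y \<otimes> t" using t s(1) carr by (simp add: m_assoc)
    moreover from this have "t \<noteq> \<one>" using False carr by auto
    ultimately show ?thesis using t(1) carr
      by (intro exI[of _ y] exI[of _ t]) (simp add: insert_commute)
  qed
  then have "{Inl x, Inl y} \<in> snd (coned_off_cayley_graph G \<P> S)"
    unfolding coned_off_cayley_graph_def by auto
  then have "(Inl x, Inl y) \<in> cone_rel G \<P> S W"
    using carr by (auto simp: cone_rel_def edge_rel_def fst_coned_off)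
  then show ?thesis by (simp add: reach_edge)
qed

lemma reach_Cay_cone_rel:
  assumes "S \<subseteq> carrier G" "(x, y) \<in> reach (Cay G S) k"
  shows "(Inl x, Inl y) \<in> reach (cone_rel G \<P> S W) k"
  using reach_map[of "Cay G S" Inl "cone_rel G \<P> S W" 1, OF Cay_cone_rel[OF assms(1)] assms(2)]
  by simp

lemma coned_off_connected:
  assumes "finite_generating_set G S" and sub: "\<And>P. P \<in> \<P> \<Longrightarrow> subgroup P G"
    and u: "u \<in> fst (coned_off_cayley_graph G \<P> S)" and v: "v \<in> fst (coned_off_cayley_graph G \<P> S)"
  shows "(u, v) \<in> (edge_rel (coned_off_cayley_graph G \<P> S))\<^sup>*"
proof -
  let ?E = "edge_rel (coned_off_cayley_graph G \<P> S)"
  have S: "S \<subseteq> carrier G" using assms(1) by (simp add: finite_generating_set_def)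
  have near: "\<exists>x\<in>carrier G. (Inl x, w) \<in> ?E\<^sup>*" if "w \<in> fst (coned_off_cayley_graph G \<P> S)" for w
  proof (cases w)
    case (Inl x)
    then show ?thesis using that by (auto simp: fst_coned_off)
  next
    case (Inr A)
    then have A: "A \<in> cosets G \<P>" using that by (auto simp: fst_coned_off)
    obtain x where x: "x \<in> A" using cosets_nonempty[OF sub A] .
    then have "(Inl x, w) \<in> ?E" using cone_relI[OF sub A _ x, of "{}"] Inr by (simp add: cone_rel_empty)
    then show ?thesis using cosets_subset_carrier[OF sub A] x by blast
  qed
  obtain x y where xy: "x \<in> carrier G" "y \<in> carrier G" "(Inl x, u) \<in> ?E\<^sup>*" "(Inl y, v) \<in> ?E\<^sup>*"
    using near[OF u] near[OF v] by blast
  obtain n where "(x, y) \<in> Cay G S ^^ n"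
    using Cay_connected[OF assms(1) xy(1,2)] rtrancl_imp_relpow by blast
  then have "(x, y) \<in> reach (Cay G S) n" by (rule reachI) simp
  then have "(Inl x, Inl y) \<in> reach ?E n"
    using reach_Cay_cone_rel[OF S, of x y n \<P> "{}"] by (simp add: cone_rel_empty)
  then have "(Inl x, Inl y) \<in> ?E\<^sup>*" by (auto elim!: reachE dest: relpow_imp_rtrancl)
  moreover have "(u, Inl x) \<in> ?E\<^sup>*" using xy(3) sym_rtrancl[OF sym_edge_rel] by (meson symD)
  ultimately show ?thesis using xy(4) by (meson rtrancl_trans)
qed

end

text \<open>The set \<open>W\<close> of cone vertices to be avoided is empty in the proof that the induced map is
  coarsely Lipschitz, and a singleton in the proof of fineness.\<close>

lemma coned_off_edge_map:
  assumes G: "group G" and H: "group H" and S: "S \<subseteq> carrier G" and T: "T \<subseteq> carrier H"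
    and sub: "\<And>Q. Q \<in> \<Q> \<Longrightarrow> subgroup Q H"
    and F: "\<And>A. A \<in> cosets G \<P> \<Longrightarrow> F A \<in> cosets H \<Q>"
    and f_edge: "\<And>x y. (x, y) \<in> Cay G S \<Longrightarrow> (f x, f y) \<in> reach (Cay H T) K"
    and f_coset: "\<And>A x. A \<in> cosets G \<P> \<Longrightarrow> x \<in> A \<Longrightarrow> \<exists>b\<in>F A. (f x, b) \<in> reach (Cay H T) K"
    and edge: "(u, v) \<in> edge_rel (coned_off_cayley_graph G \<P> S)"
    and avoid: "map_sum f F u \<notin> Inr ` W" "map_sum f F v \<notin> Inr ` W"
  shows "(map_sum f F u, map_sum f F v) \<in> reach (cone_rel H \<Q> T W) (K + 1)"
proof -
  interpret H: group H by (rule H)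
  \<comment> \<open>The detour through a nearby point \<open>b\<close> of \<open>F A\<close>
    accounts for \<open>K\<close> Cayley steps and one cone edge. Its only cone vertex is its end,
    so it avoids \<open>W\<close> as soon as \<open>F A\<close> does.\<close>
  have cone: "(Inl (f x), Inr (F A)) \<in> reach (cone_rel H \<Q> T W) (K + 1)"
    if A: "A \<in> cosets G \<P>" "x \<in> A" "F A \<notin> W" for x A
  proof -
    obtain b where b: "b \<in> F A" "(f x, b) \<in> reach (Cay H T) K" using f_coset A by blast
    have "(Inl (f x), Inl b) \<in> reach (cone_rel H \<Q> T W) K"
      using b(2) by (rule H.reach_Cay_cone_rel[OF T])
    moreover have "(Inl b, Inr (F A)) \<in> reach (cone_rel H \<Q> T W) 1"
      using H.cone_relI[OF sub F[OF A(1)] A(3) b(1)] by (simp add: reach_edge)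
    ultimately show ?thesis by (rule reach_trans)
  qed
  from S edge show ?thesis
  proof (cases rule: group.coned_off_edge_cases[OF G, consumes 2, case_names cayley to_cone from_cone])
    case (cayley g h)
    then have "(Inl (f g), Inl (f h)) \<in> reach (cone_rel H \<Q> T W) K"
      using f_edge by (intro H.reach_Cay_cone_rel[OF T]) auto
    then show ?thesis using cayley by (auto intro: reach_mono)
  next
    case (to_cone x A)
    then show ?thesis using cone avoid by auto
  next
    case (from_cone x A)
    then show ?thesis using cone[of A x] avoid by (auto intro: reach_sym[OF sym_cone_rel])
  qed
qed


section \<open>Coarse equivalences of pairs\<close>

text \<open>An infimum strictly below \<open>M\<close> is undercut by an actual point, so nearby
  points exist even if no minimum is known to be attained.\<close>

lemma hdist_lessD:
  assumes "hdist d A B < ereal M"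
  shows "a \<in> A \<Longrightarrow> \<exists>b\<in>B. d a b < M" and "b \<in> B \<Longrightarrow> \<exists>a\<in>A. d a b < M"
proof -
  assume a: "a \<in> A"
  have "(INF b\<in>B. ereal (d a b)) \<le> (SUP a\<in>A. INF b\<in>B. ereal (d a b))"
    using a by (rule SUP_upper)
  then have "(INF b\<in>B. ereal (d a b)) < ereal M"
    using assms unfolding hdist_def by (auto intro: order.strict_trans1)
  then show "\<exists>b\<in>B. d a b < M" by (auto simp: INF_less_iff)
next
  assume b: "b \<in> B"
  have "(INF a\<in>A. ereal (d a b)) \<le> (SUP b\<in>B. INF a\<in>A. ereal (d a b))"
    using b by (rule SUP_upper)
  then have "(INF a\<in>A. ereal (d a b)) < ereal M"
    using assms unfolding hdist_def by (auto intro: order.strict_trans1)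
  then show "\<exists>a\<in>A. d a b < M" by (auto simp: INF_less_iff)
qed

text \<open>The hypotheses on \<open>q\<close> ask only for uniform control of step counts, with no
  linear rates, so they do not depend on the choice of finite generating sets. \<open>R\<close> is a
  parameter because \<open>coset_rel\<close> is tied to one word metric and one bound
  \<open>M\<close>, while \<open>S\<close> and \<open>T\<close> here are the generators of the
  graphs.\<close>

locale coarse_equivalence_of_pairs = G: group G + H: group H
  for G :: "('a, 'm) monoid_scheme" and H :: "('b, 'n) monoid_scheme" +
  fixes S :: "'a set" and \<P> :: "'a set set" and T :: "'b set" and \<Q> :: "'b set set"
    and q :: "'a \<Rightarrow> 'b" and R :: "('a set \<times> 'b set) set"
  assumes gen_S: "finite_generating_set G S" and gen_T: "finite_generating_set H T"
    and fin_P: "finite \<P>" and sub_P: "\<And>P. P \<in> \<P> \<Longrightarrow> subgroup P G"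
    and sub_Q: "\<And>Q. Q \<in> \<Q> \<Longrightarrow> subgroup Q H"
    and red_P: "reduced G \<P>" and red_Q: "reduced H \<Q>"
    and q_closed: "q \<in> carrier G \<rightarrow> carrier H"
    and expand: "\<exists>K. \<forall>x\<in>carrier G. \<forall>y\<in>carrier G.
      (x, y) \<in> reach (Cay G S) k \<longrightarrow> (q x, q y) \<in> reach (Cay H T) K"
    and proper: "\<exists>K. \<forall>x\<in>carrier G. \<forall>y\<in>carrier G.
      (q x, q y) \<in> reach (Cay H T) k \<longrightarrow> (x, y) \<in> reach (Cay G S) K"
    and dense: "\<exists>K. \<forall>y\<in>carrier H. \<exists>x\<in>carrier G. (q x, y) \<in> reach (Cay H T) K"
    and close: "\<exists>K. \<forall>(A, B)\<in>R. (\<forall>a\<in>A. \<exists>b\<in>B. (q a, b) \<in> reach (Cay H T) K) \<and>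
      (\<forall>b\<in>B. \<exists>a\<in>A. (q a, b) \<in> reach (Cay H T) K)"
    and R_sub: "R \<subseteq> cosets G \<P> \<times> cosets H \<Q>"
    and R_fst: "fst ` R = cosets G \<P>" and R_snd: "snd ` R = cosets H \<Q>"
begin

lemma S_carrier: "S \<subseteq> carrier G" "finite S" and T_carrier: "T \<subseteq> carrier H" "finite T"
  using gen_S gen_T by (auto simp: finite_generating_set_def)

lemma sym_Cays: "sym (Cay G S)" "sym (Cay H T)"
  using G.sym_Cay H.sym_Cay S_carrier T_carrier by auto

definition coset_const :: nat where
  "coset_const = (SOME K. \<forall>(A, B)\<in>R. (\<forall>a\<in>A. \<exists>b\<in>B. (q a, b) \<in> reach (Cay H T) K) \<and>
      (\<forall>b\<in>B. \<exists>a\<in>A. (q a, b) \<in> reach (Cay H T) K))"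

lemma R_close:
  assumes "(A, B) \<in> R"
  shows "a \<in> A \<Longrightarrow> \<exists>b\<in>B. (q a, b) \<in> reach (Cay H T) coset_const"
    and "b \<in> B \<Longrightarrow> \<exists>a\<in>A. (q a, b) \<in> reach (Cay H T) coset_const"
  using someI_ex[OF close, folded coset_const_def] assms by auto

lemma R_cosets: "(A, B) \<in> R \<Longrightarrow> A \<in> cosets G \<P> \<and> B \<in> cosets H \<Q>"
  using R_sub by auto

lemma coset_carrier: "A \<in> cosets G \<P> \<Longrightarrow> A \<subseteq> carrier G" "B \<in> cosets H \<Q> \<Longrightarrow> B \<subseteq> carrier H"
  using G.cosets_subset_carrier[OF sub_P] H.cosets_subset_carrier[OF sub_Q] by auto

text \<open>Both \<open>B\<close> and \<open>B'\<close> are within \<open>coset_const\<close> of the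
  image of \<open>A\<close>, hence within twice that of each other.\<close>

lemma R_functional:
  assumes "(A, B) \<in> R" "(A, B') \<in> R"
  shows "B = B'"
proof (rule H.reduced_cosets_eqI[OF red_Q sub_Q T_carrier(2,1)])
  show "B \<in> cosets H \<Q>" "B' \<in> cosets H \<Q>" using assms R_cosets by auto
  fix b assume "b \<in> B"
  then obtain a where a: "a \<in> A" "(q a, b) \<in> reach (Cay H T) coset_const"
    using R_close(2)[OF assms(1)] by blast
  moreover obtain b' where "b' \<in> B'" "(q a, b') \<in> reach (Cay H T) coset_const"
    using R_close(1)[OF assms(2) a(1)] by blast
  ultimately show "\<exists>b'\<in>B'. (b, b') \<in> reach (Cay H T) (coset_const + coset_const)"
    using reach_trans[OF reach_sym[OF sym_Cays(2)]] by blast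
next
  fix b' assume "b' \<in> B'"
  then obtain a where a: "a \<in> A" "(q a, b') \<in> reach (Cay H T) coset_const"
    using R_close(2)[OF assms(2)] by blast
  moreover obtain b where "b \<in> B" "(q a, b) \<in> reach (Cay H T) coset_const"
    using R_close(1)[OF assms(1) a(1)] by blast
  ultimately show "\<exists>b\<in>B. (b, b') \<in> reach (Cay H T) (coset_const + coset_const)"
    using reach_trans[OF reach_sym[OF sym_Cays(2)]] by blast
qed

text \<open>Points of \<open>A\<close> and \<open>A'\<close> near a common point of \<open>B\<close>
  have images within \<open>2 * coset_const\<close>; \<open>proper\<close> turns this into a bound
  in \<open>G\<close>, where reducedness of \<open>\<P>\<close> applies.\<close>

lemma R_injective:
  assumes "(A, B) \<in> R" "(A', B) \<in> R"
  shows "A = A'"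
proof -
  obtain K where K: "\<And>x y. x \<in> carrier G \<Longrightarrow> y \<in> carrier G \<Longrightarrow>
      (q x, q y) \<in> reach (Cay H T) (coset_const + coset_const) \<Longrightarrow> (x, y) \<in> reach (Cay G S) K"
    using proper by meson
  have near: "\<exists>a'\<in>A'. (a, a') \<in> reach (Cay G S) K"
    if R: "(A, B) \<in> R" "(A', B) \<in> R" and a: "a \<in> A" for A A' a
  proof -
    obtain b where b: "b \<in> B" "(q a, b) \<in> reach (Cay H T) coset_const"
      using R_close(1)[OF R(1) a] by blast
    obtain a' where a': "a' \<in> A'" "(q a', b) \<in> reach (Cay H T) coset_const"
      using R_close(2)[OF R(2) b(1)] by blast
    have "(q a, q a') \<in> reach (Cay H T) (coset_const + coset_const)"
      using reach_trans[OF b(2) reach_sym[OF sym_Cays(2) a'(2)]] .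
    then show ?thesis using K R_cosets[OF R(1)] R_cosets[OF R(2)] coset_carrier a a'(1) by blast
  qed
  show ?thesis
  proof (rule G.reduced_cosets_eqI[OF red_P sub_P S_carrier(2,1)])
    show "A \<in> cosets G \<P>" "A' \<in> cosets G \<P>" using assms R_cosets by auto
  next
    fix a assume "a \<in> A"
    then show "\<exists>a'\<in>A'. (a, a') \<in> reach (Cay G S) K" by (rule near[OF assms])
  next
    fix a' assume "a' \<in> A'"
    then show "\<exists>a\<in>A. (a, a') \<in> reach (Cay G S) K"
      using near[OF assms(2,1)] reach_sym[OF sym_Cays(1)] by blast
  qed
qed

definition coset_map :: "'a set \<Rightarrow> 'b set" where
  "coset_map A = (SOME B. (A, B) \<in> R)"

definition coset_inv :: "'b set \<Rightarrow> 'a set" where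
  "coset_inv B = (SOME A. (A, B) \<in> R)"

lemma coset_map_R:
  assumes "A \<in> cosets G \<P>"
  shows "(A, coset_map A) \<in> R"
proof -
  have "\<exists>B. (A, B) \<in> R" using assms R_fst by force
  then show ?thesis unfolding coset_map_def by (rule someI_ex)
qed

lemma coset_inv_R:
  assumes "B \<in> cosets H \<Q>"
  shows "(coset_inv B, B) \<in> R"
proof -
  have "\<exists>A. (A, B) \<in> R" using assms R_snd by force
  then show ?thesis unfolding coset_inv_def by (rule someI_ex)
qed

lemma coset_map_cosets: "A \<in> cosets G \<P> \<Longrightarrow> coset_map A \<in> cosets H \<Q>"
  and coset_inv_cosets: "B \<in> cosets H \<Q> \<Longrightarrow> coset_inv B \<in> cosets G \<P>"
  using coset_map_R coset_inv_R R_cosets by auto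

lemma R_iff: "(A, B) \<in> R \<longleftrightarrow> A \<in> cosets G \<P> \<and> B = coset_map A"
  using coset_map_R R_functional R_cosets by blast

section \<open>The induced map is a quasi-isometry\<close>

definition cone_map :: "'a + 'a set \<Rightarrow> 'b + 'b set" where
  "cone_map = map_sum q coset_map"

lemma induced_map_cone_map:
  "induced_map (carrier G) (coned_off_cayley_graph G \<P> S) q R cone_map"
  unfolding induced_map_def
  by (auto simp: fst_coned_off cone_map_def R_iff)

text \<open>The order of quantifiers matters: \<open>K\<close> is fixed before \<open>W\<close>, so
  the same bound holds whichever cone vertex is to be avoided.\<close>

lemma cone_map_edge:
  obtains K where "\<And>u v W. (u, v) \<in> edge_rel (coned_off_cayley_graph G \<P> S) \<Longrightarrow>
    cone_map u \<notin> Inr ` W \<Longrightarrow> cone_map v \<notin> Inr ` W \<Longrightarrow>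
    (cone_map u, cone_map v) \<in> reach (cone_rel H \<Q> T W) K"
proof -
  obtain K where K: "\<And>x y. x \<in> carrier G \<Longrightarrow> y \<in> carrier G \<Longrightarrow>
      (x, y) \<in> reach (Cay G S) 1 \<Longrightarrow> (q x, q y) \<in> reach (Cay H T) K"
    using expand by meson
  let ?K = "K + coset_const"
  have edge: "(q x, q y) \<in> reach (Cay H T) ?K" if xy: "(x, y) \<in> Cay G S" for x y
  proof -
    have "(q x, q y) \<in> reach (Cay H T) K"
      using K[OF _ _ reach_edge[OF xy]] G.Cay_carrier[OF S_carrier(1) xy] by simp
    then show ?thesis by (rule reach_mono) simp
  qed
  have coset: "\<exists>b\<in>coset_map A. (q x, b) \<in> reach (Cay H T) ?K"
    if A: "A \<in> cosets G \<P>" "x \<in> A" for x A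
  proof -
    obtain b where "b \<in> coset_map A" "(q x, b) \<in> reach (Cay H T) coset_const"
      using R_close(1)[OF coset_map_R[OF A(1)] A(2)] by blast
    then show ?thesis by (meson reach_mono le_add2)
  qed
  show thesis
    by (rule that[of "?K + 1"], unfold cone_map_def)
      (rule coned_off_edge_map[OF G.is_group H.is_group S_carrier(1) T_carrier(1) sub_Q
          coset_map_cosets edge coset])
qed

lemma coned_off_conn:
  "u \<in> fst (coned_off_cayley_graph G \<P> S) \<Longrightarrow> v \<in> fst (coned_off_cayley_graph G \<P> S) \<Longrightarrow>
    (u, v) \<in> (edge_rel (coned_off_cayley_graph G \<P> S))\<^sup>*"
  "u' \<in> fst (coned_off_cayley_graph H \<Q> T) \<Longrightarrow> v' \<in> fst (coned_off_cayley_graph H \<Q> T) \<Longrightarrow>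
    (u', v') \<in> (edge_rel (coned_off_cayley_graph H \<Q> T))\<^sup>*"
  using G.coned_off_connected[of S \<P>] H.coned_off_connected[of T \<Q>] gen_S gen_T sub_P sub_Q
  by blast+

lemma quasi_isometry_cone_map:
  "graph_quasi_isometry (coned_off_cayley_graph G \<P> S) (coned_off_cayley_graph H \<Q> T) cone_map"
proof -
  let ?\<Gamma> = "coned_off_cayley_graph G \<P> S" and ?\<Delta> = "coned_off_cayley_graph H \<Q> T"
  obtain K0 where "\<forall>y\<in>carrier H. \<exists>x\<in>carrier G. (q x, y) \<in> reach (Cay H T) K0"
    using dense by blast
  then obtain p where p: "\<And>y. y \<in> carrier H \<Longrightarrow> p y \<in> carrier G"
    "\<And>y. y \<in> carrier H \<Longrightarrow> (q (p y), y) \<in> reach (Cay H T) K0" by metis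
  \<comment> \<open>\<open>N\<close> dominates the detours compared below:
    \<open>K0 + 1 + K0\<close> for the image of an edge under the coarse inverse \<open>p\<close>,
    \<open>K0 + coset_const\<close> for a point near a coset, and \<open>K0\<close> for
    \<open>p\<close> after \<open>q\<close>.\<close>
  define N where "N = K0 + 1 + K0 + coset_const"
  obtain K1 where K1: "\<And>x y. x \<in> carrier G \<Longrightarrow> y \<in> carrier G \<Longrightarrow>
      (q x, q y) \<in> reach (Cay H T) N \<Longrightarrow> (x, y) \<in> reach (Cay G S) K1"
    using proper by meson
  have p_edge: "(p x, p y) \<in> reach (Cay G S) K1" if xy: "(x, y) \<in> Cay H T" for x y
  proof -
    have carr: "x \<in> carrier H" "y \<in> carrier H" using H.Cay_carrier[OF T_carrier(1) xy] by auto
    have "(q (p x), q (p y)) \<in> reach (Cay H T) (K0 + 1 + K0)"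
      using reach_trans[OF reach_trans[OF p(2)[OF carr(1)] reach_edge[OF xy, of 1]]
          reach_sym[OF sym_Cays(2) p(2)[OF carr(2)]]] by simp
    then have "(q (p x), q (p y)) \<in> reach (Cay H T) N" by (rule reach_mono) (simp add: N_def)
    then show ?thesis using K1 p(1) carr by blast
  qed
  have p_coset: "\<exists>a\<in>coset_inv B. (p y, a) \<in> reach (Cay G S) K1"
    if B: "B \<in> cosets H \<Q>" "y \<in> B" for y B
  proof -
    have y: "y \<in> carrier H" using coset_carrier(2)[OF B(1)] B(2) by blast
    obtain a where a: "a \<in> coset_inv B" "(q a, y) \<in> reach (Cay H T) coset_const"
      using R_close(2)[OF coset_inv_R[OF B(1)] B(2)] by blast
    have "(q (p y), q a) \<in> reach (Cay H T) (K0 + coset_const)"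
      using reach_trans[OF p(2)[OF y] reach_sym[OF sym_Cays(2) a(2)]] .
    then have "(q (p y), q a) \<in> reach (Cay H T) N" by (rule reach_mono) (simp add: N_def)
    moreover have "a \<in> carrier G" using a(1) coset_carrier(1)[OF coset_inv_cosets[OF B(1)]] by blast
    ultimately show ?thesis using K1 p(1)[OF y] a(1) by blast
  qed
  \<comment> \<open>The coarse inverse inverts \<open>cone_map\<close> exactly on cone vertices,
    because the cosets are matched bijectively, and only up to bounded error on group
    elements.\<close>
  define r where "r = map_sum p coset_inv"
  obtain K2 where K2: "\<And>u v W. (u, v) \<in> edge_rel ?\<Gamma> \<Longrightarrow>
    cone_map u \<notin> Inr ` W \<Longrightarrow> cone_map v \<notin> Inr ` W \<Longrightarrow>
    (cone_map u, cone_map v) \<in> reach (cone_rel H \<Q> T W) K2"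
    using cone_map_edge by blast
  \<comment> \<open>One constant for all requirements: \<open>K2\<close> for edges under
    \<open>cone_map\<close>, \<open>K1 + 1\<close> for edges under \<open>r\<close>, and
    \<open>K1\<close> and \<open>K0\<close> for the two composites.\<close>
  define K where "K = K0 + (K1 + 1) + K2"
  have "quasi_isometry (real K) (2 * real K) (fst ?\<Gamma>) (rel_dist (edge_rel ?\<Gamma>))
      (fst ?\<Delta>) (rel_dist (edge_rel ?\<Delta>)) cone_map"
  proof (rule quasi_isometry_rel_distI[where g = r])
    show "cone_map \<in> fst ?\<Gamma> \<rightarrow> fst ?\<Delta>"
      using q_closed coset_map_cosets by (auto simp: cone_map_def fst_coned_off)
    show "r \<in> fst ?\<Delta> \<rightarrow> fst ?\<Gamma>"
      using p(1) coset_inv_cosets by (auto simp: r_def fst_coned_off)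
    show "sym (edge_rel ?\<Gamma>)" by (rule sym_edge_rel)
    show "1 \<le> K" by (simp add: K_def)
  next
    fix x x' assume "x \<in> fst ?\<Gamma>" "x' \<in> fst ?\<Gamma>"
    then show "(x, x') \<in> (edge_rel ?\<Gamma>)\<^sup>*" by (rule coned_off_conn)
  next
    fix y y' assume "y \<in> fst ?\<Delta>" "y' \<in> fst ?\<Delta>"
    then show "(y, y') \<in> (edge_rel ?\<Delta>)\<^sup>*" by (rule coned_off_conn)
  next
    fix u v assume "(u, v) \<in> edge_rel ?\<Gamma>"
    then have "(cone_map u, cone_map v) \<in> reach (edge_rel ?\<Delta>) K2"
      using K2[of u v "{}"] by (simp add: cone_rel_empty)
    then show "(cone_map u, cone_map v) \<in> reach (edge_rel ?\<Delta>) K"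
      by (rule reach_mono) (simp add: K_def)
  next
    fix u v assume "(u, v) \<in> edge_rel ?\<Delta>"
    then have "(r u, r v) \<in> reach (cone_rel G \<P> S {}) (K1 + 1)"
      unfolding r_def
      by (intro coned_off_edge_map[OF H.is_group G.is_group T_carrier(1) S_carrier(1) sub_P
            coset_inv_cosets p_edge p_coset]) auto
    then show "(r u, r v) \<in> reach (edge_rel ?\<Gamma>) K"
      unfolding cone_rel_empty by (rule reach_mono) (simp add: K_def)
  next
    fix u assume u: "u \<in> fst ?\<Gamma>"
    show "(r (cone_map u), u) \<in> reach (edge_rel ?\<Gamma>) K"
    proof (cases u)
      case (Inl x)
      then have x: "x \<in> carrier G" using u by (auto simp: fst_coned_off)
      then have qx: "q x \<in> carrier H" using q_closed by blast
      have "(q (p (q x)), q x) \<in> reach (Cay H T) N"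
        using p(2)[OF qx] by (rule reach_mono) (simp add: N_def)
      then have "(p (q x), x) \<in> reach (Cay G S) K1" using K1[OF p(1)[OF qx] x] by blast
      then have "(Inl (p (q x)), Inl x) \<in> reach (edge_rel ?\<Gamma>) K1"
        using G.reach_Cay_cone_rel[OF S_carrier(1), of _ _ _ \<P> "{}"] by (simp add: cone_rel_empty)
      then have "(Inl (p (q x)), Inl x) \<in> reach (edge_rel ?\<Gamma>) K"
        by (rule reach_mono) (simp add: K_def)
      then show ?thesis using Inl by (simp add: r_def cone_map_def)
    next
      case (Inr A)
      then have A: "A \<in> cosets G \<P>" using u by (auto simp: fst_coned_off)
      have "coset_inv (coset_map A) = A"
        using R_injective[OF coset_inv_R[OF coset_map_cosets[OF A]] coset_map_R[OF A]] .
      then show ?thesis using Inr by (simp add: r_def cone_map_def reach_refl)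
    qed
  next
    fix v assume v: "v \<in> fst ?\<Delta>"
    show "(cone_map (r v), v) \<in> reach (edge_rel ?\<Delta>) K"
    proof (cases v)
      case (Inl y)
      then have y: "y \<in> carrier H" using v by (auto simp: fst_coned_off)
      have "(Inl (q (p y)), Inl y) \<in> reach (edge_rel ?\<Delta>) K0"
        using H.reach_Cay_cone_rel[OF T_carrier(1) p(2)[OF y], of \<Q> "{}"]
        by (simp add: cone_rel_empty)
      then have "(Inl (q (p y)), Inl y) \<in> reach (edge_rel ?\<Delta>) K"
        by (rule reach_mono) (simp add: K_def)
      then show ?thesis using Inl by (simp add: r_def cone_map_def)
    next
      case (Inr B)
      then have B: "B \<in> cosets H \<Q>" using v by (auto simp: fst_coned_off)
      have "coset_map (coset_inv B) = B" using coset_inv_R[OF B] by (simp add: R_iff)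
      then show ?thesis using Inr by (simp add: r_def cone_map_def reach_refl)
    qed
  qed
  \<comment> \<open>The two distances agree only from a vertex of the graph, so it matters that
    \<open>cone_map\<close> sends vertices to vertices.\<close>
  moreover have "quasi_isometry L C (fst ?\<Gamma>) (graph_dist ?\<Gamma>) (fst ?\<Delta>) (graph_dist ?\<Delta>) cone_map"
    if qi: "quasi_isometry L C (fst ?\<Gamma>) (rel_dist (edge_rel ?\<Gamma>)) (fst ?\<Delta>)
      (rel_dist (edge_rel ?\<Delta>)) cone_map" for L C
  proof -
    have "cone_map \<in> fst ?\<Gamma> \<rightarrow> fst ?\<Delta>" using qi by (simp add: quasi_isometry_def)
    then have "cone_map u \<in> fst ?\<Delta>" if "u \<in> fst ?\<Gamma>" for u using that by blast
    then show ?thesis using qi by (simp add: quasi_isometry_def graph_dist_eq_rel_dist)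
  qed
  ultimately show ?thesis
    unfolding graph_quasi_isometry_def
    using connected_graphI[OF coned_off_conn(1)] connected_graphI[OF coned_off_conn(2)] by blast
qed

section \<open>Transfer of fineness\<close>

lemma finite_fibres:
  assumes "finite Z"
  shows "finite {y \<in> carrier G. q y \<in> Z}"
proof -
  \<comment> \<open>With radius 0, \<open>proper\<close> puts all points with the same image into
    one ball of the word metric, and balls are finite.\<close>
  obtain K where K: "\<And>x y. x \<in> carrier G \<Longrightarrow> y \<in> carrier G \<Longrightarrow>
      (q x, q y) \<in> reach (Cay H T) 0 \<Longrightarrow> (x, y) \<in> reach (Cay G S) K"
    using proper by meson
  have "finite {y \<in> carrier G. q y = z}" for z
  proof (cases "\<exists>x\<in>carrier G. q x = z")
    case True
    then obtain x where x: "x \<in> carrier G" "q x = z" by blast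
    have "{y \<in> carrier G. q y = z} \<subseteq> reach (Cay G S) K `` {x}"
      using K[OF x(1)] x(2) reach_refl by fastforce
    then show ?thesis by (rule finite_subset) (rule G.finite_reach_Cay[OF S_carrier(2)])
  next
    case False
    then have "{y \<in> carrier G. q y = z} = {}" by blast
    then show ?thesis by (simp only: finite.emptyI)
  qed
  moreover have "{y \<in> carrier G. q y \<in> Z} = (\<Union>z\<in>Z. {y \<in> carrier G. q y = z})" by blast
  ultimately show ?thesis using assms by simp
qed

text \<open>Since \<open>coset_map\<close> is injective, a path avoiding the cone vertex of \<open>A\<close> is mapped to one that
  avoids the cone vertex of \<open>coset_map A\<close>.\<close>

lemma cone_map_avoid:
  obtains K where "\<And>A u v n. A \<in> cosets G \<P> \<Longrightarrow> (u, v) \<in> reach (cone_rel G \<P> S {A}) n \<Longrightarrow>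
    (cone_map u, cone_map v) \<in> reach (cone_rel H \<Q> T {coset_map A}) (n * K)"
proof -
  obtain K where K: "\<And>u v W. (u, v) \<in> edge_rel (coned_off_cayley_graph G \<P> S) \<Longrightarrow>
    cone_map u \<notin> Inr ` W \<Longrightarrow> cone_map v \<notin> Inr ` W \<Longrightarrow>
    (cone_map u, cone_map v) \<in> reach (cone_rel H \<Q> T W) K"
    using cone_map_edge by blast
  have "(cone_map u, cone_map v) \<in> reach (cone_rel H \<Q> T {coset_map A}) K"
    if A: "A \<in> cosets G \<P>" and uv: "(u, v) \<in> cone_rel G \<P> S {A}" for A u v
  proof -
    note E = cone_relD[OF uv]
    have "cone_map w \<notin> Inr ` {coset_map A}"
      if w: "w \<in> fst (coned_off_cayley_graph G \<P> S)" "w \<noteq> Inr A" for w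
    proof (cases w)
      case (Inr A')
      then have "A' \<in> cosets G \<P>" "A' \<noteq> A" using w by (auto simp: fst_coned_off)
      then have "coset_map A' \<noteq> coset_map A"
        using R_injective[of A' "coset_map A" A] coset_map_R A by metis
      then show ?thesis using Inr by (auto simp: cone_map_def)
    qed (auto simp: cone_map_def)
    then show ?thesis using E by (intro K) (auto simp: edge_rel_def)
  qed
  then show thesis using reach_map[where f = cone_map] that by meson
qed

text \<open>The images \<open>q x\<close> and \<open>q y\<close> need not lie in the coset matched
  with \<open>A\<close>. Short Cayley paths, which avoid every cone vertex, move them to neighbours
  of that cone vertex, where fineness leaves finitely many choices; finite balls and finite fibres
  lead back to \<open>y\<close>.\<close>

lemma finite_angle:
  assumes fine: "fine (coned_off_cayley_graph H \<Q> T)" and A: "A \<in> cosets G \<P>" and x: "x \<in> A"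
  shows "finite {y \<in> A. (Inl y, Inl x) \<in> reach (cone_rel G \<P> S {A}) n}"
proof -
  let ?\<Delta> = "coned_off_cayley_graph H \<Q> T"
  define B where "B = coset_map A"
  have AB: "(A, B) \<in> R" and B: "B \<in> cosets H \<Q>"
    using coset_map_R[OF A] coset_map_cosets[OF A] by (auto simp: B_def)
  obtain K where K: "\<And>u v. (u, v) \<in> reach (cone_rel G \<P> S {A}) n \<Longrightarrow>
    (cone_map u, cone_map v) \<in> reach (cone_rel H \<Q> T {B}) (n * K)"
    using cone_map_avoid A unfolding B_def by metis
  obtain b0 where b0: "b0 \<in> B" "(q x, b0) \<in> reach (Cay H T) coset_const"
    using R_close(1)[OF AB x] by blast
  \<comment> \<open>From \<open>b0\<close> to \<open>q x\<close>, along the image of the avoiding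
    path to \<open>q y\<close>, and on to a point \<open>b\<close> of \<open>B\<close>.\<close>
  define m where "m = coset_const + n * K + coset_const"
  define Y where "Y = {b. {Inr B, Inl b} \<in> snd ?\<Delta> \<and>
    (Inl b0, Inl b) \<in> reach (cone_rel H \<Q> T {B}) m}"
  have edge: "{Inr B, Inl b} \<in> snd ?\<Delta>" if "b \<in> B" for b
    using B that by (auto simp: coned_off_cayley_graph_def)
  have "finite {w. {Inr B, w} \<in> snd ?\<Delta> \<and> (Inl b0, w) \<in> reach (cone_rel H \<Q> T {B}) m}"
    using fine_finite_link[OF fine, of "Inr B" "Inl b0" m] edge[OF b0(1)] B
    by (simp add: cone_rel_def fst_coned_off)
  then have "finite (Inl -` {w. {Inr B, w} \<in> snd ?\<Delta> \<and>
      (Inl b0, w) \<in> reach (cone_rel H \<Q> T {B}) m} :: 'b set)"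
    by (rule finite_vimageI) simp
  then have "finite Y" by (simp add: Y_def vimage_def)
  then have "finite (\<Union>b\<in>Y. reach (Cay H T) coset_const `` {b})"
    using H.finite_reach_Cay[OF T_carrier(2)] by blast
  then have "finite {y \<in> carrier G. q y \<in> (\<Union>b\<in>Y. reach (Cay H T) coset_const `` {b})}"
    by (rule finite_fibres)
  moreover have "q y \<in> (\<Union>b\<in>Y. reach (Cay H T) coset_const `` {b})"
    if y: "y \<in> A" "(Inl y, Inl x) \<in> reach (cone_rel G \<P> S {A}) n" for y
  proof -
    obtain b where b: "b \<in> B" "(q y, b) \<in> reach (Cay H T) coset_const"
      using R_close(1)[OF AB y(1)] by blast
    have "(Inl (q x), Inl (q y)) \<in> reach (cone_rel H \<Q> T {B}) (n * K)"
      using reach_sym[OF sym_cone_rel K[OF y(2)]] by (simp add: cone_map_def)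
    moreover have "(Inl b0, Inl (q x)) \<in> reach (cone_rel H \<Q> T {B}) coset_const"
      using reach_sym[OF sym_Cays(2) b0(2)] by (rule H.reach_Cay_cone_rel[OF T_carrier(1)])
    moreover have "(Inl (q y), Inl b) \<in> reach (cone_rel H \<Q> T {B}) coset_const"
      using b(2) by (rule H.reach_Cay_cone_rel[OF T_carrier(1)])
    ultimately have "(Inl b0, Inl b) \<in> reach (cone_rel H \<Q> T {B}) m"
      unfolding m_def by (meson reach_trans)
    then have "b \<in> Y" using edge[OF b(1)] by (simp add: Y_def)
    then show ?thesis using reach_sym[OF sym_Cays(2) b(2)] by blast
  qed
  ultimately show ?thesis using coset_carrier(1)[OF A] by (auto intro: finite_subset[rotated])
qed

text \<open>At a group element the degree is finite: \<open>S\<close> is finite and each of the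
  finitely many subgroups has one coset through it. At a cone vertex both neighbours on a circuit
  lie in the coset, and the rest of the circuit joins them outside the cone vertex.\<close>

lemma fine_coned_off:
  assumes fine: "fine (coned_off_cayley_graph H \<Q> T)"
  shows "fine (coned_off_cayley_graph G \<P> S)"
proof (rule fineI)
  fix n :: nat and u v :: "'a + 'a set"
  let ?\<Gamma> = "coned_off_cayley_graph G \<P> S"
  let ?N = "{w. \<exists>c. circuit ?\<Gamma> c \<and> length c \<le> n \<and> c ! 0 = u \<and> c ! 1 = v \<and> c ! 2 = w}"
  have N: "(w, u) \<in> reach (edge_rel (fst ?\<Gamma> - {v}, snd ?\<Gamma>)) n \<and> (u, v) \<in> edge_rel ?\<Gamma> \<and>
      (v, w) \<in> edge_rel ?\<Gamma>" if "w \<in> ?N" for w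
    using that circuit_next_vertex[of ?\<Gamma> _ n] by blast
  show "finite ?N"
  proof (cases v)
    case (Inl g)
    have "w \<in> Inl ` (reach (Cay G S) 1 `` {g}) \<union> Inr ` {A \<in> cosets G \<P>. g \<in> A}"
      if w: "w \<in> ?N" for w
    proof -
      have "(v, w) \<in> edge_rel ?\<Gamma>" using N[OF w] by blast
      with S_carrier(1) show ?thesis
        by (cases rule: G.coned_off_edge_cases) (use Inl in \<open>auto intro: reach_edge\<close>)
    qed
    then have "?N \<subseteq> Inl ` (reach (Cay G S) 1 `` {g}) \<union> Inr ` {A \<in> cosets G \<P>. g \<in> A}" by blast
    moreover have "finite \<dots>"
      using G.finite_reach_Cay[OF S_carrier(2)] G.finite_cosets_containing[OF fin_P sub_P] by blast
    ultimately show ?thesis by (rule finite_subset)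
  next
    case (Inr A)
    have nbr: "A \<in> cosets G \<P> \<and> (\<exists>y\<in>A. w = Inl y)" if "(Inr A, w) \<in> edge_rel ?\<Gamma>" for w
      using S_carrier(1) that by (cases rule: G.coned_off_edge_cases) auto
    show ?thesis
    proof (cases "?N = {}")
      case True
      then show ?thesis by (simp only: finite.emptyI)
    next
      case False
      then obtain w where "w \<in> ?N" by blast
      then have "(u, v) \<in> edge_rel ?\<Gamma>" using N by blast
      then have "(Inr A, u) \<in> edge_rel ?\<Gamma>" using sym_edge_rel Inr by (metis symD)
      then obtain x where A: "A \<in> cosets G \<P>" and x: "x \<in> A" "u = Inl x" using nbr by blast
      have "w \<in> Inl ` {y \<in> A. (Inl y, Inl x) \<in> reach (cone_rel G \<P> S {A}) n}" if "w \<in> ?N" for w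
        using N[OF that] nbr[of w] Inr x(2) by (auto simp: cone_rel_def)
      then have "?N \<subseteq> Inl ` {y \<in> A. (Inl y, Inl x) \<in> reach (cone_rel G \<P> S {A}) n}" by blast
      then show ?thesis by (rule finite_subset) (rule finite_imageI[OF finite_angle[OF fine A x(1)]])
    qed
  qed
qed

end

text \<open>The word metrics of \<open>S\<close> and \<open>T\<close> measure \<open>q\<close>,
  while \<open>S'\<close> and \<open>T'\<close> generate the graphs. Each estimate goes from step
  counts for one pair to the metrics of the other, through the inequality for \<open>q\<close>, and
  back.\<close>

lemma coarse_equivalence_of_pairsI:
  fixes G :: "('a, 'm) monoid_scheme" and H :: "('b, 'n) monoid_scheme"
  assumes G: "group G" and H: "group H"
    and S: "finite_generating_set G S" and T: "finite_generating_set H T"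
    and S': "finite_generating_set G S'" and T': "finite_generating_set H T'"
    and fin: "finite \<P>" and subP: "\<And>P. P \<in> \<P> \<Longrightarrow> subgroup P G"
    and subQ: "\<And>Q. Q \<in> \<Q> \<Longrightarrow> subgroup Q H"
    and qi: "quasi_isometry_of_pairs L C M G S \<P> H T \<Q> q"
    and red: "reduced G \<P>" "reduced H \<Q>"
  shows "coarse_equivalence_of_pairs G H S' \<P> T' \<Q> q (coset_rel G \<P> H T \<Q> M q)"
proof -
  interpret G: group G by (rule G)
  interpret H: group H by (rule H)
  let ?R = "coset_rel G \<P> H T \<Q> M q"
  obtain cG where cG: "\<And>x y k. (x, y) \<in> reach (Cay G S) k \<Longrightarrow> (x, y) \<in> reach (Cay G S') (k * cG)"
    using G.change_generating_set[OF S S'] by metis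
  obtain cG' where cG': "\<And>x y k. (x, y) \<in> reach (Cay G S') k \<Longrightarrow> (x, y) \<in> reach (Cay G S) (k * cG')"
    using G.change_generating_set[OF S' S] by metis
  obtain cH where cH: "\<And>x y k. (x, y) \<in> reach (Cay H T) k \<Longrightarrow> (x, y) \<in> reach (Cay H T') (k * cH)"
    using H.change_generating_set[OF T T'] by metis
  obtain cH' where cH': "\<And>x y k. (x, y) \<in> reach (Cay H T') k \<Longrightarrow> (x, y) \<in> reach (Cay H T) (k * cH')"
    using H.change_generating_set[OF T' T] by metis
  let ?dG = "word_dist G S" and ?dH = "word_dist H T"
  have carr: "S \<subseteq> carrier G" "T \<subseteq> carrier H" using S T by (auto simp: finite_generating_set_def)
  have G_le: "(x, y) \<in> reach (Cay G S') (nat \<lceil>r\<rceil> * cG)"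
    if "x \<in> carrier G" "y \<in> carrier G" "?dG x y \<le> r" for x y r
    using that G.word_dist_eq_rel_dist[OF carr(1)] G.Cay_connected[OF S]
    by (intro cG reach_rel_dist) auto
  have H_le: "(x, y) \<in> reach (Cay H T') (nat \<lceil>r\<rceil> * cH)"
    if "x \<in> carrier H" "y \<in> carrier H" "?dH x y \<le> r" for x y r
    using that H.word_dist_eq_rel_dist[OF carr(2)] H.Cay_connected[OF T]
    by (intro cH reach_rel_dist) auto
  have le_G: "?dG x y \<le> real (k * cG')"
    if "x \<in> carrier G" "y \<in> carrier G" "(x, y) \<in> reach (Cay G S') k" for x y k
    using rel_dist_le[OF cG'[OF that(3)]] G.word_dist_eq_rel_dist[OF carr(1) that(1,2)] by simp
  have le_H: "?dH x y \<le> real (k * cH')"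
    if "x \<in> carrier H" "y \<in> carrier H" "(x, y) \<in> reach (Cay H T') k" for x y k
    using rel_dist_le[OF cH'[OF that(3)]] H.word_dist_eq_rel_dist[OF carr(2) that(1,2)] by simp
  have q: "quasi_isometry L C (carrier G) ?dG (carrier H) ?dH q"
    and R: "fst ` ?R = cosets G \<P>" "snd ` ?R = cosets H \<Q>"
    using qi by (auto simp: quasi_isometry_of_pairs_def)
  have L: "1 \<le> L" and q_closed: "q \<in> carrier G \<rightarrow> carrier H"
    and upper: "\<And>x y. x \<in> carrier G \<Longrightarrow> y \<in> carrier G \<Longrightarrow> ?dH (q x) (q y) \<le> L * ?dG x y + C"
    and lower: "\<And>x y. x \<in> carrier G \<Longrightarrow> y \<in> carrier G \<Longrightarrow> ?dG x y / L - C \<le> ?dH (q x) (q y)"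
    and dense: "\<And>y. y \<in> carrier H \<Longrightarrow> \<exists>x\<in>carrier G. ?dH (q x) y \<le> C"
    using q by (auto simp: quasi_isometry_def)
  show ?thesis
  proof (intro coarse_equivalence_of_pairs.intro coarse_equivalence_of_pairs_axioms.intro
      G H S' T' fin subP subQ red q_closed R)
    fix k
    have "(q x, q y) \<in> reach (Cay H T') (nat \<lceil>L * real (k * cG') + C\<rceil> * cH)"
      if xy: "x \<in> carrier G" "y \<in> carrier G" "(x, y) \<in> reach (Cay G S') k" for x y
    proof (rule H_le)
      have "?dH (q x) (q y) \<le> L * ?dG x y + C" using upper xy by blast
      also have "\<dots> \<le> L * real (k * cG') + C" using le_G[OF xy] L by (simp add: mult_left_mono)
      finally show "?dH (q x) (q y) \<le> L * real (k * cG') + C" .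
    qed (use xy q_closed in auto)
    then show "\<exists>K. \<forall>x\<in>carrier G. \<forall>y\<in>carrier G.
        (x, y) \<in> reach (Cay G S') k \<longrightarrow> (q x, q y) \<in> reach (Cay H T') K" by blast
    \<comment> \<open>The radius comes from solving the lower quasi-isometry bound for the distance
      in \<open>G\<close>.\<close>
    have "(x, y) \<in> reach (Cay G S') (nat \<lceil>L * (real (k * cH') + C)\<rceil> * cG)"
      if xy: "x \<in> carrier G" "y \<in> carrier G" "(q x, q y) \<in> reach (Cay H T') k" for x y
    proof (rule G_le[OF xy(1,2)])
      have "?dH (q x) (q y) \<le> real (k * cH')" using xy q_closed by (intro le_H) auto
      then have "?dG x y / L \<le> real (k * cH') + C" using lower[OF xy(1,2)] by linarith
      then show "?dG x y \<le> L * (real (k * cH') + C)"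
        using L by (simp add: divide_le_eq mult.commute)
    qed
    then show "\<exists>K. \<forall>x\<in>carrier G. \<forall>y\<in>carrier G.
        (q x, q y) \<in> reach (Cay H T') k \<longrightarrow> (x, y) \<in> reach (Cay G S') K" by blast
  next
    have "\<exists>x\<in>carrier G. (q x, y) \<in> reach (Cay H T') (nat \<lceil>C\<rceil> * cH)" if y: "y \<in> carrier H" for y
      using dense[OF y] H_le q_closed y by blast
    then show "\<exists>K. \<forall>y\<in>carrier H. \<exists>x\<in>carrier G. (q x, y) \<in> reach (Cay H T') K" by blast
  next
    let ?K = "nat \<lceil>M\<rceil> * cH"
    have "(\<forall>a\<in>A. \<exists>b\<in>B. (q a, b) \<in> reach (Cay H T') ?K) \<and>
        (\<forall>b\<in>B. \<exists>a\<in>A. (q a, b) \<in> reach (Cay H T') ?K)" if AB: "(A, B) \<in> ?R" for A B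
    proof -
      have "A \<in> cosets G \<P>" "B \<in> cosets H \<Q>" and M: "hdist ?dH (q ` A) B < ereal M"
        using AB by (auto simp: coset_rel_def)
      then have sub: "A \<subseteq> carrier G" "B \<subseteq> carrier H"
        using G.cosets_subset_carrier[OF subP] H.cosets_subset_carrier[OF subQ] by auto
      have le: "(q a, b) \<in> reach (Cay H T') ?K" if "a \<in> A" "b \<in> B" "?dH (q a) b < M" for a b
        using that sub q_closed by (intro H_le) auto
      show ?thesis
        using hdist_lessD[OF M] le by blast
    qed
    then show "\<exists>K. \<forall>(A, B)\<in>?R. (\<forall>a\<in>A. \<exists>b\<in>B. (q a, b) \<in> reach (Cay H T') K) \<and>
        (\<forall>b\<in>B. \<exists>a\<in>A. (q a, b) \<in> reach (Cay H T') K)" by blast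
  next
    show "?R \<subseteq> cosets G \<P> \<times> cosets H \<Q>" by (auto simp: coset_rel_def)
  qed
qed

theorem theorem3:
  fixes G :: "('a, 'm) monoid_scheme" and H :: "('b, 'n) monoid_scheme"
    and S S' :: "'a set" and T T' :: "'b set"
    and \<P> :: "'a set set" and \<Q> :: "'b set set"
    and q :: "'a \<Rightarrow> 'b" and L C M :: real
  assumes "group G" and "group H"
    and "finite_generating_set G S" and "finite_generating_set H T"
    and "finite_generating_set G S'" and "finite_generating_set H T'"
    and "finite \<P>" and "\<And>P. P \<in> \<P> \<Longrightarrow> subgroup P G"
    and "finite \<Q>" and "\<And>Q. Q \<in> \<Q> \<Longrightarrow> subgroup Q H"
    and "quasi_isometry_of_pairs L C M G S \<P> H T \<Q> q"
    and "reduced G \<P>" and "reduced H \<Q>"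
  shows "(\<exists>q'. induced_map (carrier G) (coned_off_cayley_graph G \<P> S') q
              (coset_rel G \<P> H T \<Q> M q) q' \<and>
            graph_quasi_isometry (coned_off_cayley_graph G \<P> S')
              (coned_off_cayley_graph H \<Q> T') q') \<and>
         (fine (coned_off_cayley_graph H \<Q> T') \<longrightarrow> fine (coned_off_cayley_graph G \<P> S'))"
proof -
  interpret coarse_equivalence_of_pairs G H S' \<P> T' \<Q> q "coset_rel G \<P> H T \<Q> M q"
    by (rule coarse_equivalence_of_pairsI[OF assms(1-8) assms(10-13)])
  show ?thesis
    using induced_map_cone_map quasi_isometry_cone_map fine_coned_off by blast
qed

end
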